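(* For every natural number $k\ge 1$ and every $\epsilon>0$ there exist constants $C>0$ and $N$, depending only on $k$ and $\epsilon$, such that the following holds for every $n>N$. Let $E\subset\mathbb{R}^2$ be a set of $n$ points with the property that no two distinct points of $E$ lie on a common line through the origin, and let $(\alpha_1,\dots,\alpha_k)$ be a $k$-tuple of nonzero real numbers. Then the number of $k$-chains of type $(\alpha_1,\dots,\alpha_k)$ in $E$ consisting of pairwise distinct points is at most $$C\cdot\begin{cases} n^{\frac{k+3}{3}} & \text{if } k\equiv 0 \pmod 3,\\ n^{\frac{k+3}{3}+\epsilon} & \text{if } k\equiv 1 \pmod 3,\\ n^{\frac{k+4}{3}} & \text{if } k\equiv 2 \pmod 3. \end{cases}$$
   Context: For a $k$-tuple $(\alpha_1,\dots,\alpha_k)$ of real numbers, a $k$-chain of type $(\alpha_1,\dots,\alpha_k)$ in a finite set $E$ is a $(k+1)$-tuple $(R_1,\dots,R_{k+1})\in E^{k+1}$ such that $R_j\cdot R_{j+1}=\alpha_j$ for all $j=1,\dots,k$, where $\cdot$ is the standard dot product. *)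

theory Defs
  imports "HOL-Analysis.Analysis"
begin

(* A tuple is a list, read from index 0: the entries of Rs are R_1, ..., R_(k+1) and those of
   as are alpha_1, ..., alpha_k, where k = length as.  Chains may repeat points. *)
definition dot_chains :: "real list \<Rightarrow> ('a::real_inner) set \<Rightarrow> 'a list set" where
  "dot_chains as E = {Rs. length Rs = length as + 1 \<and> set Rs \<subseteq> E \<and>
                      (\<forall>j<length as. (Rs ! j) \<bullet> (Rs ! (j + 1)) = as ! j)}"

end

theory Submission
  imports Defs
begin

text \<open>
  Fix nonzero \<open>\<alpha>\<^sub>1, \<dots>, \<alpha>\<^sub>k\<close> and join two points \<open>P\<close>, \<open>R\<close> at stage \<open>j\<close> when \<open>P \<bullet> R = \<alpha>\<^sub>j\<close>.  Two
  things are needed from the geometry.  First, the points joined to \<open>P\<close> lie on a line, and the lines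
  belonging to different points of \<open>E\<close> meet at most once, so the Szemeredi--Trotter theorem bounds the
  number of joined pairs in \<open>X \<times> Y\<close> by a constant times \<open>|X|^(2/3) |Y|^(2/3) + |X| + |Y|\<close>.  Second, two distinct
  points \<open>P\<close>, \<open>Q\<close> are linked by at most one point \<open>R\<close>, because \<open>P \<bullet> R\<close> and \<open>Q \<bullet> R\<close> determine \<open>R\<close>.
  From here on only these two facts about a sequence of relations on an \<open>n\<close>-point set are used, and
  chains are counted as walks that never return to a point after two steps.

  Heuristically each step should multiply the count by \<open>n^(1/3)\<close>, giving \<open>n^((k+3)/3)\<close>; the obstruction is a star,
  a few points joined to very many.  The weight of the walks ending at a point is measured by the smallest
  \<open>\<kappa>\<close> with \<open>\<Sum>\<^sub>A g \<le> \<kappa> |A|^(2/3)\<close> for all \<open>A\<close> (a weak \<open>L\<^sup>3\<close> norm).  Summing over the points of degree at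
  least \<open>r\<close>, for every \<open>r\<close>, the incidence bound shows that pushing \<open>g\<close> along one relation multiplies this norm by
  \<open>O(n^(1/3))\<close>, up to a part \<open>h\<close> carried by at most \<open>n^(1/2)\<close> star centres and of total mass \<open>O(\<kappa> n^(2/3))\<close>
  (\<open>push_split\<close>).  The part \<open>h\<close> is harmless two steps later: since the midpoint of a two-step path is
  determined by its ends, \<open>h\<close> then contributes at most its total mass to each single point
  (\<open>two_step_sum\<close>).  Iterating gives \<open>walks_decomposition\<close>.

  Only the last step can meet a star that has not yet been flattened.  If the last but one point has fewer than
  \<open>n^(1/2)\<close> forward neighbours, the decomposition gives \<open>n^((k+3)/3)\<close>.  The remaining points have \<open>O(n)\<close> forward
  neighbours altogether, and by uniqueness of midpoints each of them ends at most as many walks as there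
  are walks with \<open>k - 3\<close> steps.  So the number \<open>T(k)\<close> of walks satisfies \<open>T(k) = O(n T(k-3) + n^((k+3)/3))\<close>.
  The starting values \<open>n\<close>, \<open>n^(4/3)\<close>, \<open>n\<^sup>2\<close> account for the three residue classes.

  The Szemeredi--Trotter theorem is proved by Szekely's method: join consecutive points on each line,
  and compare the number of edges of this drawing with its number of crossings.
\<close>

section \<open>Plane straight-line graphs\<close>

type_synonym edge = "(real \<times> real) \<times> (real \<times> real)"

definition slope :: "edge \<Rightarrow> real" where
  "slope e = (snd (snd e) - snd (fst e)) / (fst (snd e) - fst (fst e))"

definition height :: "edge \<Rightarrow> real \<Rightarrow> real" where
  "height e t = snd (fst e) + slope e * (t - fst (fst e))"

definition spans :: "edge \<Rightarrow> real \<Rightarrow> bool" where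
  "spans e t \<longleftrightarrow> fst (fst e) < t \<and> t < fst (snd e)"

definition crossing :: "edge \<Rightarrow> edge \<Rightarrow> bool" where
  "crossing e f \<longleftrightarrow> (\<exists>t. spans e t \<and> spans f t \<and> height e t = height f t)"

text \<open>
  A drawing with straight edges, each oriented from left to right.  Vertices have distinct first
  coordinates, so no edge is vertical, and no vertex lies inside an edge; edges may cross.
\<close>

locale straight_line_graph =
  fixes V :: "(real \<times> real) set" and D :: "edge set"
  assumes finite_V: "finite V"
    and inj_V: "inj_on fst V"
    and D_sub: "D \<subseteq> V \<times> V"
    and left_right: "e \<in> D \<Longrightarrow> fst (fst e) < fst (snd e)"
    and no_vertex_inside: "e \<in> D \<Longrightarrow> w \<in> V \<Longrightarrow> spans e (fst w) \<Longrightarrow> height e (fst w) \<noteq> snd w"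
begin

lemma finite_D: "finite D"
  using finite_subset[OF D_sub] finite_V by blast

lemma ends_in_V: "e \<in> D \<Longrightarrow> fst e \<in> V" "e \<in> D \<Longrightarrow> snd e \<in> V"
  using D_sub by (force simp: mem_Times_iff)+

lemma height_left: "height e (fst (fst e)) = snd (fst e)"
  by (simp add: height_def)

lemma height_from_right:
  assumes "e \<in> D"
  shows "height e t = snd (snd e) - slope e * (fst (snd e) - t)"
  using left_right[OF assms] by (simp add: height_def slope_def field_simps)

lemma height_right: "e \<in> D \<Longrightarrow> height e (fst (snd e)) = snd (snd e)"
  by (simp add: height_from_right)

lemma vertex_eqI: "u \<in> V \<Longrightarrow> v \<in> V \<Longrightarrow> fst u = fst v \<Longrightarrow> u = v"
  using inj_V by (auto dest: inj_onD)

text \<open>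
  The heights are affine in \<open>t\<close>, so a change of order would force a common point at a parameter
  strictly between \<open>t0\<close> and \<open>t\<close>, which is a crossing even if \<open>t0\<close> and \<open>t\<close> are endpoints.
\<close>

lemma order_preserved:
  assumes nc: "\<not> crossing e f"
    and t0: "fst (fst e) \<le> t0" "t0 \<le> fst (snd e)" "fst (fst f) \<le> t0" "t0 \<le> fst (snd f)"
    and t: "fst (fst e) \<le> t" "t \<le> fst (snd e)" "fst (fst f) \<le> t" "t \<le> fst (snd f)"
    and less: "height e t0 < height f t0"
  shows "height e t \<le> height f t"
proof (rule ccontr)
  assume "\<not> ?thesis"
  then have gt: "height f t < height e t" by simp
  define p q where "p = height f t0 - height e t0" and "q = height e t - height f t"
  have pq: "p > 0" "q > 0" using less gt by (auto simp: p_def q_def)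
  define s where "s = (q * t0 + p * t) / (p + q)"
  have tt: "t \<noteq> t0" using less gt by auto
  have eq: "height e s = height f s"
  proof -
    have aff: "(p + q) * height g s = q * height g t0 + p * height g t" for g
    proof -
      have "(p + q) * s = q * t0 + p * t" using pq by (simp add: s_def)
      moreover have "(p + q) * height g s
          = (p + q) * (snd (fst g) - slope g * fst (fst g)) + slope g * ((p + q) * s)"
        by (simp add: height_def algebra_simps)
      ultimately show ?thesis by (simp add: height_def algebra_simps)
    qed
    have "(p + q) * (height e s - height f s) = 0"
      unfolding right_diff_distrib aff by (simp add: p_def q_def algebra_simps)
    then show ?thesis using pq by auto
  qed
  have between: "min t t0 < s" "s < max t t0"
  proof -
    have *: "s = t0 + p / (p + q) * (t - t0)" "s = t + q / (p + q) * (t0 - t)"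
      using pq by (simp_all add: s_def field_simps)
    have pos: "p / (p + q) > 0" "q / (p + q) > 0" using pq by auto
    show "min t t0 < s" "s < max t t0"
      using *(1) *(2) pos tt mult_pos_pos[OF pos(1)] mult_pos_pos[OF pos(2)]
      by (smt (verit) mult_pos_neg)+
  qed
  have "spans e s" "spans f s" using between t t0 by (auto simp: spans_def)
  with eq nc show False by (auto simp: crossing_def)
qed

text \<open>
  A charging argument replaces Euler's formula.  Every edge \<open>e\<close> from \<open>u\<close> to \<open>v\<close> is of one of three kinds:
  the steepest edge leaving \<open>u\<close> to the right (\<open>D1\<close>), the uppermost edge arriving at \<open>v\<close> from the left (\<open>D2\<close>),
  or the edge directly below some vertex \<open>w\<close> (\<open>D3\<close>).  The vertex \<open>u\<close>, \<open>v\<close> or \<open>w\<close> determines \<open>e\<close> within its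
  kind, hence the factor \<open>3\<close>.  That no edge escapes is seen by looking at the wedge between \<open>e\<close> and the
  next edge \<open>e1\<close> above it at \<open>u\<close>: unless \<open>e\<close> is uppermost at \<open>v\<close>, the wedge contains a vertex, and its
  leftmost vertex has \<open>e\<close> directly below it.
\<close>

lemma plane_edge_bound:
  assumes nc: "\<And>e f. e \<in> D \<Longrightarrow> f \<in> D \<Longrightarrow> e \<noteq> f \<Longrightarrow> \<not> crossing e f"
  shows "card D \<le> 3 * card V"
proof -
  define below where "below e w \<longleftrightarrow> spans e (fst w) \<and> height e (fst w) < snd w" for e and w :: "real \<times> real"
  define D1 where "D1 = {e \<in> D. \<forall>f\<in>D. fst f = fst e \<longrightarrow> slope f \<le> slope e}"
  define D2 where "D2 = {e \<in> D. \<forall>f\<in>D. snd f = snd e \<longrightarrow> slope e \<le> slope f}"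
  define D3 where "D3 = {e \<in> D. \<exists>w\<in>V. below e w \<and>
                      (\<forall>f\<in>D. below f w \<longrightarrow> height f (fst w) \<le> height e (fst w))}"
  have "card D1 \<le> card V"
  proof (rule card_inj_on_le)
    show "inj_on fst D1"
    proof (rule inj_onI, rule ccontr)
      fix e f assume ef: "e \<in> D1" "f \<in> D1" "fst e = fst f" "e \<noteq> f"
      then have D: "e \<in> D" "f \<in> D" and sl: "slope e = slope f" by (auto simp: D1_def intro: antisym)
      then have h: "height e t = height f t" for t using ef by (simp add: height_def)
      obtain t where "fst (fst e) < t" "t < min (fst (snd e)) (fst (snd f))"
        using dense[of "fst (fst e)" "min (fst (snd e)) (fst (snd f))"] left_right[OF D(1)] left_right[OF D(2)] ef
        by auto
      then have "crossing e f" using h ef(3) by (auto simp: crossing_def spans_def)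
      then show False using nc[OF D ef(4)] by simp
    qed
    show "fst ` D1 \<subseteq> V" using ends_in_V by (auto simp: D1_def)
  qed (rule finite_V)
  moreover have "card D2 \<le> card V"
  proof (rule card_inj_on_le)
    show "inj_on snd D2"
    proof (rule inj_onI, rule ccontr)
      fix e f assume ef: "e \<in> D2" "f \<in> D2" "snd e = snd f" "e \<noteq> f"
      then have D: "e \<in> D" "f \<in> D" and sl: "slope e = slope f" by (auto simp: D2_def intro: antisym)
      then have h: "height e t = height f t" for t using ef by (simp add: height_from_right)
      obtain t where "max (fst (fst e)) (fst (fst f)) < t" "t < fst (snd e)"
        using dense[of "max (fst (fst e)) (fst (fst f))" "fst (snd e)"] left_right[OF D(1)] left_right[OF D(2)] ef
        by auto
      then have "crossing e f" using h ef(3) by (auto simp: crossing_def spans_def)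
      then show False using nc[OF D ef(4)] by simp
    qed
    show "snd ` D2 \<subseteq> V" using ends_in_V by (auto simp: D2_def)
  qed (rule finite_V)
  moreover have "card D3 \<le> card V"
  proof -
    have "\<forall>e\<in>D3. \<exists>w. w \<in> V \<and> below e w \<and>
                      (\<forall>f\<in>D. below f w \<longrightarrow> height f (fst w) \<le> height e (fst w))"
      unfolding D3_def by blast
    then obtain W where W: "\<And>e. e \<in> D3 \<Longrightarrow> W e \<in> V \<and> below e (W e) \<and>
                      (\<forall>f\<in>D. below f (W e) \<longrightarrow> height f (fst (W e)) \<le> height e (fst (W e)))"
      by metis
    show ?thesis
    proof (rule card_inj_on_le)
      show "inj_on W D3"
      proof (rule inj_onI, rule ccontr)
        fix e f assume ef: "e \<in> D3" "f \<in> D3" "W e = W f" "e \<noteq> f"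
        then have D: "e \<in> D" "f \<in> D" by (auto simp: D3_def)
        have "height e (fst (W e)) = height f (fst (W e))"
          using W[OF ef(1)] W[OF ef(2)] ef(3) D by (intro antisym) auto
        then have "crossing e f"
          using W[OF ef(1)] W[OF ef(2)] ef(3) by (auto simp: crossing_def below_def)
        then show False using nc[OF D ef(4)] by simp
      qed
      show "W ` D3 \<subseteq> V" using W by auto
    qed (rule finite_V)
  qed
  moreover have "D \<subseteq> D1 \<union> D2 \<union> D3"
  proof
    fix e assume e: "e \<in> D"
    show "e \<in> D1 \<union> D2 \<union> D3"
    proof (rule ccontr)
      assume no: "e \<notin> D1 \<union> D2 \<union> D3"
      define u v where "u = fst e" and "v = snd e"
      have uv: "fst u < fst v" using left_right[OF e] by (simp add: u_def v_def)
      define S where "S = {f \<in> D. fst f = u \<and> slope e < slope f}"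
      have "finite S" using finite_D by (simp add: S_def)
      moreover have "S \<noteq> {}" using no e unfolding S_def D1_def u_def not_le[symmetric] by blast
      ultimately obtain e1 where "e1 \<in> S" and least: "\<And>f. f \<in> S \<Longrightarrow> slope e1 \<le> slope f"
        by (meson arg_min_if_finite(1) arg_min_least)
      then have e1: "e1 \<in> D" "fst e1 = u" "slope e < slope e1" by (auto simp: S_def)
      obtain e2 where e2: "e2 \<in> D" "snd e2 = v" "slope e2 < slope e"
        using no e by (auto simp: D2_def v_def not_le)
      define w1 where "w1 = snd e1"
      have uw1: "fst u < fst w1" using left_right[OF e1(1)] e1(2) by (simp add: w1_def)
      have he: "height e t = snd u + slope e * (t - fst u)" for t by (simp add: height_def u_def)
      have he1: "height e1 t = snd u + slope e1 * (t - fst u)" for t by (simp add: height_def e1(2))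
      have he': "height e t = snd v - slope e * (fst v - t)" for t
        using height_from_right[OF e] by (simp add: v_def)
      have he2: "height e2 t = snd v - slope e2 * (fst v - t)" for t
        using height_from_right[OF e2(1)] by (simp add: e2(2))
      have e_e1: "height e t < height e1 t" if "fst u < t" for t
        using that e1(3) by (simp add: he he1)
      have e_e2: "height e t < height e2 t" if "t < fst v" for t
        using that e2(3) by (simp add: he' he2)
      \<comment> \<open>The vertices in the wedge between \<open>e\<close> and \<open>e1\<close>.\<close>
      define R where "R = {w \<in> V. spans e (fst w) \<and> fst w \<le> fst w1 \<and>
                              height e (fst w) < snd w \<and> snd w \<le> height e1 (fst w)}"
      have "R \<noteq> {}"
      proof (cases "fst w1 < fst v")
        case True
        then have "w1 \<in> R"
          using e_e1[OF uw1] uw1 ends_in_V[OF e1(1)] height_right[OF e1(1)]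
          by (auto simp: R_def w1_def spans_def u_def v_def)
        then show ?thesis by auto
      next
        case False
        \<comment> \<open>Here \<open>e1\<close> passes above \<open>v\<close>, so \<open>e2\<close> is trapped below it and its left endpoint lies in the wedge.\<close>
        define z where "z = fst e2"
        have zv: "fst z < fst v" using left_right[OF e2(1)] e2(2) by (simp add: z_def)
        have "e1 \<noteq> e2" using e1 e2 by auto
        then have nc12: "\<not> crossing e2 e1" using nc e1 e2 by auto
        have at_v: "height e2 (fst v) < height e1 (fst v)"
          using e_e1[OF uv] by (simp add: he2 he')
        have le: "height e2 t \<le> height e1 t" if "fst u \<le> t" "fst z \<le> t" "t \<le> fst v" for t
          by (rule order_preserved[OF nc12 _ _ _ _ _ _ _ _ at_v])
            (use that False uv zv uw1 e1 e2 in \<open>auto simp: z_def w1_def\<close>)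
        have uz: "fst u < fst z"
        proof (rule ccontr)
          assume "\<not> fst u < fst z"
          then have "height e2 (fst u) \<le> height e1 (fst u)" using uv by (intro le) auto
          moreover have "height e (fst u) < height e2 (fst u)" using e_e2[OF uv] .
          ultimately show False by (simp add: he he1)
        qed
        have "height e2 (fst z) = snd z" by (simp add: z_def height_left)
        then have "z \<in> R"
          using e_e2[OF zv] le[of "fst z"] uz zv False ends_in_V[OF e2(1)]
          by (auto simp: R_def spans_def u_def v_def z_def)
        then show ?thesis by auto
      qed
      moreover have "finite R" using finite_V by (auto simp: R_def)
      ultimately obtain w where w: "w \<in> R" and leftmost: "\<And>w'. w' \<in> R \<Longrightarrow> fst w \<le> fst w'"
        by (meson arg_min_if_finite(1) arg_min_least)
      have w': "w \<in> V" "fst u < fst w" "fst w < fst v" "fst w \<le> fst w1"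
          "height e (fst w) < snd w" "snd w \<le> height e1 (fst w)"
        using w by (auto simp: R_def spans_def u_def v_def)
      \<comment> \<open>An edge \<open>f\<close> separating \<open>e\<close> from \<open>w\<close> would, followed to the left, either end in the wedge before \<open>w\<close>
        or be squeezed into \<open>u\<close>, between the neighbouring edges \<open>e\<close> and \<open>e1\<close>.\<close>
      have "height f (fst w) \<le> height e (fst w)" if f: "f \<in> D" "below f w" for f
      proof (rule ccontr)
        assume "\<not> ?thesis"
        then have ef: "height e (fst w) < height f (fst w)" by simp
        have fe1: "height f (fst w) < height e1 (fst w)" using f(2) w' by (simp add: below_def)
        have nc': "\<not> crossing e f" "\<not> crossing f e1" using nc e e1 f(1) ef fe1 by (metis less_irrefl)+
        define z where "z = fst f"
        have fw: "fst z < fst w" "fst w < fst (snd f)" using f(2) by (auto simp: below_def spans_def z_def)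
        have hz: "height f (fst z) = snd z" by (simp add: z_def height_left)
        have zV: "z \<in> V" using ends_in_V[OF f(1)] by (simp add: z_def)
        have le: "height e t \<le> height f t \<and> height f t \<le> height e1 t"
          if "fst u \<le> t" "fst z \<le> t" "t \<le> fst w" for t
        proof
          show "height e t \<le> height f t"
            by (rule order_preserved[OF nc'(1) _ _ _ _ _ _ _ _ ef])
              (use that w' fw in \<open>auto simp: u_def v_def z_def\<close>)
          show "height f t \<le> height e1 t"
            by (rule order_preserved[OF nc'(2) _ _ _ _ _ _ _ _ fe1])
              (use that w' fw e1 in \<open>auto simp: u_def v_def z_def w1_def\<close>)
        qed
        show False
        proof (cases "fst u < fst z")
          case True
          have "spans e (fst z)" using True fw w' by (auto simp: spans_def u_def v_def)
          moreover from this have "height e (fst z) < snd z"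
            using le[of "fst z"] no_vertex_inside[OF e zV] True fw hz by auto
          moreover have "snd z \<le> height e1 (fst z)" using le[of "fst z"] True fw hz by auto
          ultimately have "z \<in> R" using zV fw w' by (auto simp: R_def)
          then show False using leftmost[of z] fw by simp
        next
          case False
          have hu: "height f (fst u) = snd u"
            using le[of "fst u"] False w' by (auto simp: he he1)
          have uV: "u \<in> V" using ends_in_V[OF e] by (simp add: u_def)
          have "fst z = fst u"
            using no_vertex_inside[OF f(1) uV] hu False fw w' by (fastforce simp: spans_def z_def)
          then have "fst f = u" using vertex_eqI[OF zV uV] by (simp add: z_def)
          then have hf: "height f t = snd u + slope f * (t - fst u)" for t by (simp add: height_def)
          have "slope e < slope f" "slope f < slope e1"
            using ef fe1 w' by (simp_all add: he he1 hf)
          then have "f \<in> S" using f(1) \<open>fst f = u\<close> by (simp add: S_def)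
          then show False using least[of f] \<open>slope f < slope e1\<close> by simp
        qed
      qed
      then have "e \<in> D3"
        using e w' unfolding D3_def below_def spans_def u_def v_def by auto
      then show False using no by simp
    qed
  qed
  ultimately show ?thesis
  proof -
    assume a: "card D1 \<le> card V" "card D2 \<le> card V" "card D3 \<le> card V" "D \<subseteq> D1 \<union> D2 \<union> D3"
    have fin: "finite (D1 \<union> D2 \<union> D3)" using finite_D by (auto simp: D1_def D2_def D3_def)
    have "card D \<le> card (D1 \<union> D2 \<union> D3)" using card_mono[OF fin a(4)] .
    also have "\<dots> \<le> card (D1 \<union> D2) + card D3" by (rule card_Un_le)
    also have "\<dots> \<le> card D1 + card D2 + card D3" using card_Un_le[of D1 D2] by simp
    finally show ?thesis using a by linarith
  qed
qed

end

section \<open>Crossings\<close>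

context straight_line_graph
begin

text \<open>
  Two edges with a common endpoint that meet again overlap, and then the shorter one ends inside the
  longer one.  So a crossing involves four distinct vertices; this is the source of the fourth power
  in \<open>sampled_crossing_bound\<close>.
\<close>

lemma crossing_edges_disjoint:
  assumes D: "e \<in> D" "f \<in> D" and "e \<noteq> f" and cr: "crossing e f"
  shows "fst e \<noteq> fst f" "fst e \<noteq> snd f" "snd e \<noteq> fst f" "snd e \<noteq> snd f"
proof -
  obtain t where t: "spans e t" "spans f t" "height e t = height f t"
    using cr by (auto simp: crossing_def)
  show "fst e \<noteq> snd f" "snd e \<noteq> fst f" using t by (auto simp: spans_def)
  show "fst e \<noteq> fst f"
  proof
    assume eq: "fst e = fst f"
    then have "slope e = slope f" using t by (auto simp: height_def spans_def)
    with eq have h: "height e s = height f s" for s by (simp add: height_def)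
    have "\<not> fst (snd e) < fst (snd f)"
      using no_vertex_inside[OF D(2) ends_in_V(2)[OF D(1)]] left_right[OF D(1)] eq
        height_right[OF D(1)] by (auto simp: spans_def h)
    moreover have "\<not> fst (snd f) < fst (snd e)"
      using no_vertex_inside[OF D(1) ends_in_V(2)[OF D(2)]] left_right[OF D(2)] eq
        height_right[OF D(2)] by (auto simp: spans_def h)
    ultimately have "snd e = snd f" using vertex_eqI ends_in_V D by simp
    then show False using eq \<open>e \<noteq> f\<close> by (simp add: prod_eq_iff)
  qed
  show "snd e \<noteq> snd f"
  proof
    assume eq: "snd e = snd f"
    then have "slope e = slope f"
      using t D by (auto simp: height_from_right spans_def)
    with eq have h: "height e s = height f s" for s using D by (simp add: height_from_right)
    have "\<not> fst (fst e) < fst (fst f)"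
      using no_vertex_inside[OF D(1) ends_in_V(1)[OF D(2)]] left_right[OF D(2)] eq
        height_left[of f] by (auto simp: spans_def h)
    moreover have "\<not> fst (fst f) < fst (fst e)"
      using no_vertex_inside[OF D(2) ends_in_V(1)[OF D(1)]] left_right[OF D(1)] eq
        height_left[of e] by (auto simp: spans_def h)
    ultimately have "fst e = fst f" using vertex_eqI ends_in_V D by simp
    then show False using eq \<open>e \<noteq> f\<close> by (simp add: prod_eq_iff)
  qed
qed

end

definition crossings :: "edge set \<Rightarrow> (edge \<times> edge) set" where
  "crossings D = {(e, f) \<in> D \<times> D. e \<noteq> f \<and> crossing e f}"

lemma straight_line_graph_subset:
  assumes "straight_line_graph V D" "U \<subseteq> V" "F \<subseteq> D" "F \<subseteq> U \<times> U"
  shows "straight_line_graph U F"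
proof -
  interpret straight_line_graph V D by fact
  show ?thesis
  proof
    show "finite U" using assms(2) finite_V finite_subset by auto
    show "inj_on fst U" using inj_V assms(2) inj_on_subset by blast
    show "height e (fst w) \<noteq> snd w" if "e \<in> F" "w \<in> U" "spans e (fst w)" for e w
      using that no_vertex_inside assms by blast
  qed (use assms left_right in auto)
qed

text \<open>
  Removing one edge from every crossing pair leaves a plane drawing.
\<close>

lemma edges_le_vertices_plus_crossings:
  assumes "straight_line_graph V D"
  shows "card D \<le> 3 * card V + card (crossings D)"
  using assms
proof (induction "card D" arbitrary: D)
  case 0
  then show ?case by simp
next
  case (Suc m)
  interpret straight_line_graph V D by fact
  have fin: "finite (crossings D)"
    by (rule finite_subset[of _ "D \<times> D"]) (auto simp: crossings_def finite_D)
  show ?case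
  proof (cases "crossings D = {}")
    case True
    then have "\<not> crossing e f" if "e \<in> D" "f \<in> D" "e \<noteq> f" for e f
      using that unfolding crossings_def by blast
    then show ?thesis using plane_edge_bound by fastforce
  next
    case False
    then obtain e f where ef: "(e, f) \<in> crossings D" by auto
    then have e: "e \<in> D" by (auto simp: crossings_def)
    have "straight_line_graph V (D - {e})"
      by (rule straight_line_graph_subset[OF Suc.prems]) (use D_sub in auto)
    moreover have "m = card (D - {e})" using Suc.hyps e finite_D by simp
    ultimately have "card (D - {e}) \<le> 3 * card V + card (crossings (D - {e}))"
      using Suc.hyps by blast
    moreover have "card (crossings (D - {e})) < card (crossings D)"
      using ef by (intro psubset_card_mono[OF fin]) (auto simp: crossings_def)
    ultimately show ?thesis using Suc.hyps(2) e finite_D by simp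
  qed
qed

section \<open>The crossing lemma by random sampling\<close>

text \<open>
  The probability that a random subset of \<open>V\<close>, containing each point independently with probability \<open>p\<close>,
  equals \<open>S\<close>.
\<close>

definition sample_weight :: "real \<Rightarrow> 'a set \<Rightarrow> 'a set \<Rightarrow> real" where
  "sample_weight p V S = p ^ card S * (1 - p) ^ card (V - S)"

text \<open>
  Algebraically, this expands a product over \<open>V\<close> whose factors are \<open>p + 0\<close> on \<open>T\<close> and \<open>p + (1 - p)\<close>
  elsewhere.
\<close>

lemma sample_weight_superset:
  assumes "finite V" "T \<subseteq> V"
  shows "(\<Sum>S | S \<in> Pow V \<and> T \<subseteq> S. sample_weight p V S) = p ^ card T"
proof -
  have "(\<Sum>S | S \<in> Pow V \<and> T \<subseteq> S. sample_weight p V S)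
      = (\<Sum>S\<in>Pow V. if T \<subseteq> S then sample_weight p V S else 0)"
    using assms(1) by (simp only: finite_Pow_iff sum.inter_filter)
  also have "\<dots> = (\<Sum>S\<in>Pow V. (\<Prod>x\<in>S. p) * (\<Prod>x\<in>V - S. if x \<in> T then 0 else 1 - p))"
  proof (rule sum.cong)
    fix S assume S: "S \<in> Pow V"
    have fin: "finite (V - S)" using assms(1) by simp
    show "(if T \<subseteq> S then sample_weight p V S else 0)
        = (\<Prod>x\<in>S. p) * (\<Prod>x\<in>V - S. if x \<in> T then 0 else 1 - p)"
    proof (cases "T \<subseteq> S")
      case True
      then have "(\<Prod>x\<in>V - S. if x \<in> T then 0 else 1 - p) = (\<Prod>x\<in>V - S. 1 - p)"
        by (intro prod.cong) auto
      then show ?thesis using True by (simp add: sample_weight_def)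
    next
      case False
      then have "\<exists>x\<in>V - S. (if x \<in> T then 0 else 1 - p) = 0" using assms(2) by auto
      then have "(\<Prod>x\<in>V - S. if x \<in> T then 0 else 1 - p) = 0" using fin by (intro prod_zero) auto
      then show ?thesis using False by simp
    qed
  qed simp
  also have "\<dots> = (\<Prod>x\<in>V. p + (if x \<in> T then 0 else 1 - p))"
    using prod_add[OF assms(1), of "\<lambda>_. p"] by simp
  also have "\<dots> = (\<Prod>x\<in>V. if x \<in> T then p else 1)" by (intro prod.cong) auto
  also have "\<dots> = p ^ card T"
    using assms by (simp add: prod.If_cases Int_absorb1)
  finally show ?thesis .
qed

lemma expected_surviving:
  assumes "finite V" "finite M" and sub: "\<And>m. m \<in> M \<Longrightarrow> T m \<subseteq> V" and c: "\<And>m. m \<in> M \<Longrightarrow> card (T m) = c"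
  shows "(\<Sum>S\<in>Pow V. sample_weight p V S * card {m \<in> M. T m \<subseteq> S}) = p ^ c * card M"
proof -
  have "(\<Sum>S\<in>Pow V. sample_weight p V S * card {m \<in> M. T m \<subseteq> S})
      = (\<Sum>S\<in>Pow V. \<Sum>m | m \<in> M \<and> T m \<subseteq> S. sample_weight p V S)"
    by (simp add: mult.commute)
  also have "\<dots> = (\<Sum>m\<in>M. \<Sum>S | S \<in> Pow V \<and> T m \<subseteq> S. sample_weight p V S)"
    using assms(1,2) by (intro sum.swap_restrict) auto
  also have "\<dots> = (\<Sum>m\<in>M. p ^ c)"
    by (intro sum.cong refl) (simp only: sample_weight_superset[OF assms(1) sub] c)
  finally show ?thesis by simp
qed

text \<open>
  The amplification step of the crossing lemma: take the expectation of \<open>edges_le_vertices_plus_crossings\<close> over a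
  random set of vertices, where an edge survives with probability \<open>p\<^sup>2\<close> and a crossing only with \<open>p\<^sup>4\<close>.
\<close>

lemma sampled_crossing_bound:
  fixes p :: real
  assumes "straight_line_graph V D" and p: "0 \<le> p" "p \<le> 1"
  shows "p ^ 2 * card D \<le> 3 * p * card V + p ^ 4 * card (crossings D)"
proof -
  interpret straight_line_graph V D by fact
  let ?w = "sample_weight p V"
  define T2 where "T2 e = {fst e, snd e}" for e :: edge
  define T4 where "T4 = (\<lambda>(e, f). {fst e, snd e, fst f, snd f :: real \<times> real})"
  have fin: "finite (crossings D)"
    by (rule finite_subset[of _ "D \<times> D"]) (auto simp: crossings_def finite_D)
  have ends: "fst e \<in> V" "snd e \<in> V" "fst e \<noteq> snd e" if "e \<in> D" for e
    using ends_in_V left_right[OF that] that by auto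
  have "p ^ 2 * card D = (\<Sum>S\<in>Pow V. ?w S * card {e \<in> D. T2 e \<subseteq> S})"
    by (rule expected_surviving[symmetric]) (auto simp: finite_V finite_D T2_def ends)
  also have "\<dots> \<le> (\<Sum>S\<in>Pow V. ?w S * (3 * card {v \<in> V. {v} \<subseteq> S} + card {x \<in> crossings D. T4 x \<subseteq> S}))"
  proof (intro sum_mono mult_left_mono)
    fix S assume S: "S \<in> Pow V"
    have "card {e \<in> D. T2 e \<subseteq> S} \<le> 3 * card S + card (crossings {e \<in> D. T2 e \<subseteq> S})"
      by (rule edges_le_vertices_plus_crossings, rule straight_line_graph_subset[OF assms(1)])
        (use S in \<open>auto simp: T2_def mem_Times_iff\<close>)
    also have "crossings {e \<in> D. T2 e \<subseteq> S} = {x \<in> crossings D. T4 x \<subseteq> S}"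
      by (auto simp: crossings_def T2_def T4_def)
    also have "card S = card {v \<in> V. {v} \<subseteq> S}" using S by (intro arg_cong[of _ _ card]) auto
    finally show "real (card {e \<in> D. T2 e \<subseteq> S})
        \<le> real (3 * card {v \<in> V. {v} \<subseteq> S} + card {x \<in> crossings D. T4 x \<subseteq> S})" by simp
    show "0 \<le> ?w S" using p by (simp add: sample_weight_def)
  qed
  also have "\<dots> = 3 * (\<Sum>S\<in>Pow V. ?w S * card {v \<in> V. {v} \<subseteq> S})
                + (\<Sum>S\<in>Pow V. ?w S * card {x \<in> crossings D. T4 x \<subseteq> S})"
    by (simp add: algebra_simps sum.distrib sum_distrib_left)
  also have "(\<Sum>S\<in>Pow V. ?w S * card {v \<in> V. {v} \<subseteq> S}) = p ^ 1 * card V"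
    by (rule expected_surviving) (auto simp: finite_V)
  also have "(\<Sum>S\<in>Pow V. ?w S * card {x \<in> crossings D. T4 x \<subseteq> S}) = p ^ 4 * card (crossings D)"
  proof (rule expected_surviving[OF finite_V fin])
    fix x assume "x \<in> crossings D"
    then obtain e f where x: "x = (e, f)" "e \<in> D" "f \<in> D" "e \<noteq> f" "crossing e f"
      unfolding crossings_def by blast
    show "T4 x \<subseteq> V" using ends[OF x(2)] ends[OF x(3)] by (simp add: x(1) T4_def)
    show "card (T4 x) = 4"
      using ends[OF x(2)] ends[OF x(3)] crossing_edges_disjoint[OF x(2-5)] by (simp add: x(1) T4_def)
  qed
  finally show ?thesis by simp
qed

section \<open>The Szemeredi--Trotter theorem\<close>

lemma root_3_power:
  assumes "x > 0" shows "root 3 x ^ m = x powr (m / 3)"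
  using assms by (simp add: root_powr_inverse powr_power)

lemma powr_two_thirds:
  assumes "x \<ge> 0" shows "x powr (2/3) = (root 3 x)\<^sup>2"
  using assms root_3_power[of x 2] by (cases "x = 0") auto

text \<open>
  The edges join consecutive points on each \<open>l i\<close>; convexity keeps them inside \<open>l i\<close>.  Each
  \<open>l i\<close> that meets \<open>P\<close> has one edge fewer than points, and an ordered pair of indices accounts for at most
  one crossing, since the crossing point is the common point of the two sets.  So the sampled bound applies with at most
  \<open>(card I)\<^sup>2\<close> crossings.
\<close>

theorem incidence_bound_injective_fst:
  fixes P :: "(real \<times> real) set" and l :: "'i \<Rightarrow> (real \<times> real) set"
  assumes fin: "finite P" "finite I" and inj: "inj_on fst P"
    and conv: "\<And>i. i \<in> I \<Longrightarrow> convex (l i)"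
    and one: "\<And>i j u v. i \<in> I \<Longrightarrow> j \<in> I \<Longrightarrow> i \<noteq> j \<Longrightarrow> u \<in> l i \<inter> l j \<Longrightarrow> v \<in> l i \<inter> l j \<Longrightarrow> u = v"
  shows "real (\<Sum>i\<in>I. card (P \<inter> l i))
    \<le> 4 * (real (card P) powr (2/3) * real (card I) powr (2/3) + card P + card I)"
proof -
  define Di where "Di i = {(u, v). u \<in> P \<inter> l i \<and> v \<in> P \<inter> l i \<and> fst u < fst v \<and>
                        (\<forall>w\<in>P \<inter> l i. \<not> (fst u < fst w \<and> fst w < fst v))}" for i
  define D where "D = (\<Union>i\<in>I. Di i)"
  have Di: "fst e \<in> P" "fst e \<in> l i" "snd e \<in> P" "snd e \<in> l i" "fst (fst e) < fst (snd e)"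
    "w \<in> P \<Longrightarrow> w \<in> l i \<Longrightarrow> \<not> spans e (fst w)" if "e \<in> Di i" for e i w
    using that by (auto simp: Di_def spans_def)
  have on_line: "(t, height e t) \<in> l i" if e: "e \<in> Di i" "i \<in> I" and t: "spans e t" for e i t
  proof -
    define s where "s = (t - fst (fst e)) / (fst (snd e) - fst (fst e))"
    have s: "0 \<le> s" "s \<le> 1" using t by (auto simp: s_def spans_def)
    have "s * (fst (snd e) - fst (fst e)) = t - fst (fst e)" using Di(5)[OF e(1)] by (simp add: s_def)
    then have "(1 - s) * fst (fst e) + s * fst (snd e) = t" by (simp add: algebra_simps)
    moreover have "slope e * (t - fst (fst e)) = s * (snd (snd e) - snd (fst e))"
      by (simp add: slope_def s_def)
    then have "(1 - s) * snd (fst e) + s * snd (snd e) = height e t"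
      by (simp add: height_def algebra_simps)
    ultimately have "(t, height e t) = (1 - s) *\<^sub>R fst e + s *\<^sub>R snd e"
      by (simp add: prod_eq_iff)
    also have "\<dots> \<in> l i" using convexD_alt[OF conv[OF e(2)] Di(2)[OF e(1)] Di(4)[OF e(1)] s] .
    finally show ?thesis .
  qed
  have same: "e = f" if ef: "e \<in> Di i" "f \<in> Di i" and t: "spans e t" "spans f t" for e f i t
  proof -
    have *: "fst (fst g) \<ge> fst (fst h)" "fst (snd g) \<ge> fst (snd h)"
      if "g \<in> Di i" "h \<in> Di i" "spans g t" "spans h t" for g h
      using Di[OF that(1)] Di[OF that(2)] that(3,4) unfolding spans_def by (meson less_trans not_le)+
    have "fst (fst e) = fst (fst f)" "fst (snd e) = fst (snd f)"
      using *[OF ef t] *[OF ef(2,1) t(2,1)] by auto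
    then have "fst e = fst f" "snd e = snd f" using inj Di ef by (metis inj_onD)+
    then show ?thesis by (simp add: prod_eq_iff)
  qed
  have graph: "straight_line_graph P D"
  proof
    show "D \<subseteq> P \<times> P" by (auto simp: D_def Di_def)
    show "fst (fst e) < fst (snd e)" if "e \<in> D" for e using that Di(5) unfolding D_def by blast
    fix e w assume e: "e \<in> D" and w: "w \<in> P" "spans e (fst w)"
    then obtain i where i: "i \<in> I" "e \<in> Di i" by (auto simp: D_def)
    show "height e (fst w) \<noteq> snd w"
    proof
      assume "height e (fst w) = snd w"
      then have "w \<in> l i" using on_line[OF i(2,1) w(2)] by simp
      then show False using Di(6)[OF i(2)] w by auto
    qed
  qed (use fin inj in auto)
  interpret straight_line_graph P D by (rule graph)
  have card_D: "card D = (\<Sum>i\<in>I. card (Di i))"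
    unfolding D_def
  proof (rule card_UN_disjoint)
    show "\<forall>i\<in>I. finite (Di i)"
      using finite_D fin(2) by (auto simp: D_def)
    show "\<forall>i\<in>I. \<forall>j\<in>I. i \<noteq> j \<longrightarrow> Di i \<inter> Di j = {}"
    proof (intro ballI impI, rule ccontr)
      fix i j assume ij: "i \<in> I" "j \<in> I" "i \<noteq> j" "Di i \<inter> Di j \<noteq> {}"
      then obtain e where e: "e \<in> Di i" "e \<in> Di j" by auto
      then have "fst e = snd e" using one[OF ij(1-3)] Di[OF e(1)] Di[OF e(2)] by auto
      then show False using Di(5)[OF e(1)] by simp
    qed
  qed (rule fin)
  have line: "card (P \<inter> l i) \<le> card (Di i) + 1" if i: "i \<in> I" for i
  proof (cases "P \<inter> l i = {}")
    case False
    let ?Q = "P \<inter> l i"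
    have finQ: "finite ?Q" using fin by simp
    define m where "m = arg_min_on (\<lambda>z. - fst z) ?Q"
    have m: "m \<in> ?Q" "\<And>z. z \<in> ?Q \<Longrightarrow> fst z \<le> fst m"
      using arg_min_if_finite(1)[OF finQ False, of "\<lambda>z. - fst z"]
        arg_min_least[OF finQ False, of _ "\<lambda>z. - fst z"] by (auto simp: m_def)
    have "?Q - {m} \<subseteq> fst ` Di i"
    proof
      fix u assume u: "u \<in> ?Q - {m}"
      let ?N = "{w \<in> ?Q. fst u < fst w}"
      have "fst u \<noteq> fst m" using u m(1) inj by (auto dest: inj_onD)
      then have "m \<in> ?N" using u m(1) m(2)[of u] by auto
      then have N: "finite ?N" "?N \<noteq> {}" using finite_subset[OF _ finQ, of ?N] by blast+
      define v where "v = arg_min_on fst ?N"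
      have v: "v \<in> ?N" "\<And>w. w \<in> ?N \<Longrightarrow> fst v \<le> fst w"
        using arg_min_if_finite(1)[OF N, of fst] arg_min_least[OF N, of _ fst] by (simp_all add: v_def)
      have "(u, v) \<in> Di i" using u v(1) v(2) by (force simp: Di_def not_less)
      then show "u \<in> fst ` Di i" by force
    qed
    moreover have "finite (Di i)" using finite_D i by (auto simp: D_def intro: finite_subset)
    ultimately have "card (?Q - {m}) \<le> card (Di i)"
      using card_image_le card_mono finite_imageI le_trans by metis
    then show ?thesis using m(1) finQ by simp
  qed simp
  have "(\<Sum>i\<in>I. card (P \<inter> l i)) \<le> (\<Sum>i\<in>I. card (Di i) + 1)" by (intro sum_mono line)
  also have "\<dots> = card D + card I" by (simp only: sum.distrib card_D) simp
  finally have incid: "(\<Sum>i\<in>I. card (P \<inter> l i)) \<le> card D + card I" .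
  have "card (crossings D) \<le> card (I \<times> I)"
  proof -
    have "\<forall>e\<in>D. \<exists>i. i \<in> I \<and> e \<in> Di i" by (auto simp: D_def)
    then obtain k where k: "\<And>e. e \<in> D \<Longrightarrow> k e \<in> I \<and> e \<in> Di (k e)" by metis
    show ?thesis
    proof (rule card_inj_on_le)
      show "inj_on (\<lambda>(e, f). (k e, k f)) (crossings D)"
      proof (rule inj_onI, clarify)
        fix e f e' f' assume x: "(e, f) \<in> crossings D" "(e', f') \<in> crossings D"
          and kk: "k e = k e'" "k f = k f'"
        have D: "e \<in> D" "f \<in> D" "e' \<in> D" "f' \<in> D" "e \<noteq> f" using x by (auto simp: crossings_def)
        obtain t where t: "spans e t" "spans f t" "height e t = height f t"
          using x(1) by (auto simp: crossings_def crossing_def)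
        obtain t' where t': "spans e' t'" "spans f' t'" "height e' t' = height f' t'"
          using x(2) by (auto simp: crossings_def crossing_def)
        have kne: "k e \<noteq> k f" using same[of e "k e" f t] k[OF D(1)] k[OF D(2)] D(5) t by metis
        have "(t, height e t) = (t', height e' t')"
        proof (rule one[of "k e" "k f"])
          show "(t, height e t) \<in> l (k e) \<inter> l (k f)"
            using on_line[of e "k e" t] on_line[of f "k f" t] k D t by auto
          show "(t', height e' t') \<in> l (k e) \<inter> l (k f)"
            using on_line[of e' "k e" t'] on_line[of f' "k f" t'] k D t' kk by auto
        qed (use k D kne in auto)
        then have "t = t'" by simp
        then show "e = e' \<and> f = f'"
          using same[of e "k e" e'] same[of f "k f" f'] k D t t' kk by metis
      qed
      show "(\<lambda>(e, f). (k e, k f)) ` crossings D \<subseteq> I \<times> I"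
        using k by (auto simp: crossings_def)
    qed (use fin in auto)
  qed
  then have cr: "real (card (crossings D)) \<le> real (card I) ^ 2"
    by (simp add: power2_eq_square card_cartesian_product flip: of_nat_mult)
  have samp: "p ^ 2 * card D \<le> 3 * p * card P + p ^ 4 * real (card I) ^ 2" if "0 \<le> p" "p \<le> 1" for p :: real
    using sampled_crossing_bound[OF graph that] mult_left_mono[OF cr, of "p ^ 4"] that by force
  have "card D \<le> 4 * (real (card P) powr (2/3) * real (card I) powr (2/3)) + 4 * card P"
  proof (cases "real (card I) ^ 2 \<le> card P")
    case True
    have "card D \<le> 4 * real (card P)" using samp[of 1] True unfolding power_one by linarith
    also have "\<dots> \<le> 4 * (real (card P) powr (2/3) * real (card I) powr (2/3)) + 4 * card P" by simp
    finally show ?thesis by simp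
  next
    case False
    define a b where "a = root 3 (card P)" and "b = root 3 (card I)"
    then have a: "a \<ge> 0" "real (card P) = a ^ 3" and b: "b \<ge> 0" "real (card I) = b ^ 3" by simp_all
    show ?thesis
    proof (cases "a = 0")
      case True
      then have "P = {}" using a fin by simp
      then have "D = {}" using D_sub by auto
      then show ?thesis by simp
    next
      case a0: False
      have lt: "a ^ 3 < (b ^ 2) ^ 3" using False a b by (simp flip: power_mult)
      then have ab: "a < b ^ 2" by (rule power_less_imp_less_base) simp
      have pos: "a > 0" "b > 0" using a a0 ab b by (auto intro: le_neq_trans)
      \<comment> \<open>This \<open>p\<close> balances \<open>3 a\<^sup>3 / p\<close> against \<open>p\<^sup>2 b\<^sup>6\<close>; it is at most \<open>1\<close> as there are fewer points than pairs of lines.\<close>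
      define p where "p = a / b ^ 2"
      have p: "0 < p" "p \<le> 1" using pos ab by (auto simp: p_def)
      have "p ^ 2 * card D \<le> 3 * p * a ^ 3 + p ^ 4 * (b ^ 3) ^ 2"
        using samp[of p] p a b by simp
      also have "\<dots> = p ^ 2 * (4 * (a ^ 2 * b ^ 2))"
        using pos by (simp add: p_def field_simps power2_eq_square power3_eq_cube power4_eq_xxxx)
      finally have "card D \<le> 4 * (a ^ 2 * b ^ 2)" using p by simp
      then show ?thesis by (simp add: powr_two_thirds a_def b_def)
    qed
  qed
  moreover have "real (\<Sum>i\<in>I. card (P \<inter> l i)) \<le> real (card D) + card I"
    using incid by (simp only: of_nat_mono flip: of_nat_add)
  ultimately show ?thesis by simp
qed

text \<open>
  A generic shear makes the first coordinates of the points distinct, and preserves convexity and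
  incidences.
\<close>

theorem Szemeredi_Trotter_convex:
  fixes P :: "(real ^ 2) set" and l :: "'i \<Rightarrow> (real ^ 2) set"
  assumes fin: "finite P" "finite I"
    and conv: "\<And>i. i \<in> I \<Longrightarrow> convex (l i)"
    and one: "\<And>i j u v. i \<in> I \<Longrightarrow> j \<in> I \<Longrightarrow> i \<noteq> j \<Longrightarrow> u \<in> l i \<inter> l j \<Longrightarrow> v \<in> l i \<inter> l j \<Longrightarrow> u = v"
  shows "real (\<Sum>i\<in>I. card (P \<inter> l i))
    \<le> 4 * (real (card P) powr (2/3) * real (card I) powr (2/3) + card P + card I)"
proof -
  \<comment> \<open>The finitely many shears that give two of the points the same first coordinate.\<close>
  define B where "B = (\<lambda>(u, v). (v$1 - u$1) / (u$2 - v$2)) ` (P \<times> P)"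
  have "finite B" using fin by (simp add: B_def)
  then obtain s :: real where s: "s \<notin> B" using ex_new_if_finite infinite_UNIV_char_0 by blast
  define T where "T z = (z$1 + s * z$2, z$2)" for z :: "real ^ 2"
  have lin: "linear T"
    by (rule linearI) (auto simp: T_def algebra_simps)
  have injT: "inj T" by (rule injI) (auto simp: T_def vec_eq_iff forall_2)
  have injf: "inj_on fst (T ` P)"
  proof (rule inj_on_imageI, rule inj_onI)
    fix u v assume "u \<in> P" "v \<in> P" "(fst \<circ> T) u = (fst \<circ> T) v"
    then have uv: "u \<in> P" "v \<in> P" "fst (T u) = fst (T v)" by auto
    show "u = v"
    proof (cases "u$2 = v$2")
      case True
      then have "T u = T v" using uv by (simp add: T_def)
      then show ?thesis using injT by (simp add: inj_eq)
    next
      case False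
      then have "s = (v$1 - u$1) / (u$2 - v$2)" using uv by (simp add: T_def field_simps)
      then have "s \<in> B" using uv by (auto simp: B_def)
      then show ?thesis using s by simp
    qed
  qed
  have cards: "card (T ` A) = card A" for A using card_image inj_on_subset[OF injT] by blast
  have "real (\<Sum>i\<in>I. card (T ` P \<inter> T ` l i))
    \<le> 4 * (real (card (T ` P)) powr (2/3) * real (card I) powr (2/3) + card (T ` P) + card I)"
  proof (rule incidence_bound_injective_fst)
    show "convex (T ` l i)" if "i \<in> I" for i using convex_linear_image[OF lin conv[OF that]] .
  next
    fix i j u v assume ij: "i \<in> I" "j \<in> I" "i \<noteq> j" "u \<in> T ` l i \<inter> T ` l j" "v \<in> T ` l i \<inter> T ` l j"
    then have "u \<in> T ` (l i \<inter> l j)" "v \<in> T ` (l i \<inter> l j)" by (simp_all add: image_Int[OF injT])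
    then show "u = v" using one[OF ij(1-3)] by auto
  qed (use fin injf in auto)
  then show ?thesis by (simp add: image_Int[OF injT, symmetric] cards)
qed

section \<open>Two elementary sums\<close>

lemma sum_inverse_squares_tail:
  assumes "1 \<le> m" "m \<le> N"
  shows "(\<Sum>r\<in>{m<..N}. 1 / (real r)\<^sup>2) \<le> 1 / real m - 1 / real N"
  using assms(2)
proof (induction N rule: dec_induct)
  case (step N)
  have "{m<..Suc N} = insert (Suc N) {m<..N}" using step by auto
  then have "(\<Sum>r\<in>{m<..Suc N}. 1 / (real r)\<^sup>2) \<le> 1 / (real (Suc N))\<^sup>2 + (1 / real m - 1 / real N)"
    using step by simp
  also have "1 / (real (Suc N))\<^sup>2 \<le> 1 / real N - 1 / real (Suc N)"
  proof -
    have "real N > 0" using assms(1) step by simp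
    moreover have "1 / (x + 1)\<^sup>2 \<le> 1 / x - 1 / (x + 1)" if "x > 0" for x :: real
      using that by (simp add: divide_simps) (simp add: power2_eq_square algebra_simps)
    ultimately show ?thesis by (metis of_nat_Suc add.commute)
  qed
  finally show ?case by simp
qed simp

lemma sum_min_inverse_squares:
  fixes a b :: real
  assumes "a > 0" "b \<ge> 0"
  shows "(\<Sum>r=1..N. min (a\<^sup>2) ((b / real r)\<^sup>2)) \<le> a\<^sup>2 + 2 * a * b"
proof (cases "b = 0")
  case True
  have "min (a\<^sup>2) ((b / real r)\<^sup>2) = 0" for r using True by (simp add: min_def)
  then show ?thesis using True by simp
next
  case False
  then have b: "b > 0" using assms by simp
  define m where "m = nat \<lceil>b / a\<rceil>"
  have m: "b / a \<le> m" "m \<le> b / a + 1" "1 \<le> m"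
    using assms b divide_pos_pos[OF b assms(1)] unfolding m_def by linarith+
  have "(\<Sum>r=1..N. min (a\<^sup>2) ((b / real r)\<^sup>2)) \<le> (\<Sum>r\<in>{1..m} \<union> {m<..N}. min (a\<^sup>2) ((b / real r)\<^sup>2))"
    by (rule sum_mono2) auto
  also have "\<dots> = (\<Sum>r=1..m. min (a\<^sup>2) ((b / real r)\<^sup>2)) + (\<Sum>r\<in>{m<..N}. min (a\<^sup>2) ((b / real r)\<^sup>2))"
    by (rule sum.union_disjoint) auto
  also have "(\<Sum>r=1..m. min (a\<^sup>2) ((b / real r)\<^sup>2)) \<le> (\<Sum>r=1..m. a\<^sup>2)" by (rule sum_mono) simp
  also have "\<dots> = m * a\<^sup>2" by simp
  also have "\<dots> \<le> (b / a + 1) * a\<^sup>2" using m(2) by (intro mult_right_mono) auto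
  also have "\<dots> = a * b + a\<^sup>2" using assms(1) by (simp add: field_simps power2_eq_square)
  also have "(\<Sum>r\<in>{m<..N}. min (a\<^sup>2) ((b / real r)\<^sup>2)) \<le> a * b"
  proof (cases "m \<le> N")
    case True
    have "(\<Sum>r\<in>{m<..N}. min (a\<^sup>2) ((b / real r)\<^sup>2)) \<le> (\<Sum>r\<in>{m<..N}. b\<^sup>2 * (1 / (real r)\<^sup>2))"
      by (rule sum_mono) (simp add: power_divide)
    also have "\<dots> = b\<^sup>2 * (\<Sum>r\<in>{m<..N}. 1 / (real r)\<^sup>2)" by (simp only: sum_distrib_left)
    also have "\<dots> \<le> b\<^sup>2 * (1 / real m)"
    proof (rule mult_left_mono)
      have "1 / real N \<ge> 0" by simp
      then show "(\<Sum>r\<in>{m<..N}. 1 / (real r)\<^sup>2) \<le> 1 / real m"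
        using sum_inverse_squares_tail[OF m(3) True] by linarith
    qed simp
    also have "\<dots> \<le> b * a"
      using m b assms(1) by (simp add: field_simps power2_eq_square)
    finally show ?thesis by (simp add: mult.commute)
  next
    case False
    then show ?thesis using assms by simp
  qed
  finally show ?thesis by simp
qed

lemma sum_inverse_two_thirds:
  "(\<Sum>r=1..N. 1 / (root 3 (real r))\<^sup>2) \<le> 3 * root 3 (real N)"
proof (induction N)
  case (Suc N)
  define x y where "x = root 3 (real (Suc N))" and "y = root 3 (real N)"
  have xy: "x > 0" "y \<ge> 0" "y \<le> x" "x ^ 3 - y ^ 3 = 1" by (auto simp: x_def y_def)
  have "1 = (x - y) * (x\<^sup>2 + x * y + y\<^sup>2)"
    unfolding xy(4)[symmetric] by (simp add: algebra_simps power2_eq_square power3_eq_cube)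
  also have "\<dots> \<le> (x - y) * (3 * x\<^sup>2)"
  proof (rule mult_left_mono)
    have "x * y \<le> x * x" "y * y \<le> x * x" using xy by (auto intro: mult_mono)
    then show "x\<^sup>2 + x * y + y\<^sup>2 \<le> 3 * x\<^sup>2" by (simp add: power2_eq_square)
  qed (use xy in simp)
  finally have "1 / x\<^sup>2 \<le> 3 * (x - y)" using xy(1) by (simp add: field_simps)
  then show ?case using Suc by (simp add: x_def y_def)
qed simp

section \<open>Counting walks without immediate return\<close>

text \<open>
  Carrying a set \<open>X\<close> of forbidden values for the last but one point turns the condition that no point recurs
  two steps later, which involves three consecutive points, into a recursion on the last point \<open>S\<close>.
\<close>

primrec walks :: "(nat \<Rightarrow> 'a \<Rightarrow> 'a \<Rightarrow> bool) \<Rightarrow> 'a set \<Rightarrow> nat \<Rightarrow> 'a \<Rightarrow> 'a set \<Rightarrow> real" where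
  "walks G E 0 S X = 1"
| "walks G E (Suc i) S X = (\<Sum>R | R \<in> E - X \<and> G i R S. walks G E i R {S})"

lemma walks_nonneg: "walks G E i S X \<ge> 0"
  by (induction i arbitrary: S X) (auto intro: sum_nonneg)

lemma walks_mono: "finite E \<Longrightarrow> walks G E i S X \<le> walks G E i S {}"
  by (cases i) (auto intro!: sum_mono2 walks_nonneg)

definition walk_lists :: "(nat \<Rightarrow> 'a \<Rightarrow> 'a \<Rightarrow> bool) \<Rightarrow> 'a set \<Rightarrow> nat \<Rightarrow> 'a list set" where
  "walk_lists G E k = {Rs. length Rs = k + 1 \<and> set Rs \<subseteq> E \<and> (\<forall>j<k. G j (Rs ! j) (Rs ! (j + 1))) \<and>
                           (\<forall>j. j + 2 \<le> k \<longrightarrow> Rs ! j \<noteq> Rs ! (j + 2))}"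

lemma finite_walk_lists: "finite E \<Longrightarrow> finite (walk_lists G E k)"
  by (rule finite_subset[of _ "{Rs. set Rs \<subseteq> E \<and> length Rs = k + 1}"])
    (auto simp: walk_lists_def intro: finite_lists_length_eq)

lemma card_walk_lists_ending:
  assumes fin: "finite E"
  shows "real (card {Rs \<in> walk_lists G E k. Rs ! k = S \<and> (k > 0 \<longrightarrow> Rs ! (k - 1) \<notin> X)}) \<le> walks G E k S X"
proof (induction k arbitrary: S X)
  case 0
  have "{Rs \<in> walk_lists G E 0. Rs ! 0 = S} \<subseteq> {[S]}"
    by (auto simp: walk_lists_def length_Suc_conv)
  then have "card {Rs \<in> walk_lists G E 0. Rs ! 0 = S} \<le> card {[S]}" by (intro card_mono) auto
  then show ?case by simp
next
  case (Suc k)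
  let ?W = "\<lambda>k S X. {Rs \<in> walk_lists G E k. Rs ! k = S \<and> (k > 0 \<longrightarrow> Rs ! (k - 1) \<notin> X)}"
  let ?J = "{R. R \<in> E - X \<and> G k R S}"
  have J: "finite ?J" using fin by simp
  have finW: "finite (?W k R {S})" for R using finite_walk_lists[OF fin] by simp
  have "?W (Suc k) S X \<subseteq> (\<Union>R\<in>?J. (\<lambda>Rs. Rs @ [S]) ` ?W k R {S})"
  proof
    fix Rs assume Rs: "Rs \<in> ?W (Suc k) S X"
    then have len: "length Rs = Suc k + 1" and E: "set Rs \<subseteq> E"
      and G: "\<And>j. j < Suc k \<Longrightarrow> G j (Rs ! j) (Rs ! (j + 1))"
      and ne: "\<And>j. j + 2 \<le> Suc k \<Longrightarrow> Rs ! j \<noteq> Rs ! (j + 2)"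
      and S: "Rs ! Suc k = S" and X: "Rs ! k \<notin> X" by (auto simp: walk_lists_def)
    define Ts where "Ts = butlast Rs"
    have nth: "Ts ! j = Rs ! j" if "j \<le> k" for j using that len by (simp add: Ts_def nth_butlast)
    have "Rs \<noteq> []" using len by auto
    then have "last Rs = S" using S len by (simp add: last_conv_nth)
    with \<open>Rs \<noteq> []\<close> have eq: "Rs = Ts @ [S]" by (auto simp: Ts_def)
    have "Ts \<in> walk_lists G E k"
      unfolding walk_lists_def
      using len E G ne nth by (auto simp: Ts_def dest: in_set_butlastD)
    moreover have "k > 0 \<longrightarrow> Ts ! (k - 1) \<noteq> S"
      using ne[of "k - 1"] nth[of "k - 1"] S by auto
    ultimately have "Ts \<in> ?W k (Rs ! k) {S}" using nth by simp
    moreover have "Rs ! k \<in> ?J" using X E G[of k] S len by auto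
    ultimately show "Rs \<in> (\<Union>R\<in>?J. (\<lambda>Rs. Rs @ [S]) ` ?W k R {S})" using eq by blast
  qed
  then have "card (?W (Suc k) S X) \<le> card (\<Union>R\<in>?J. (\<lambda>Rs. Rs @ [S]) ` ?W k R {S})"
    using J finW by (intro card_mono finite_UN_I finite_imageI) auto
  also have "\<dots> \<le> (\<Sum>R\<in>?J. card ((\<lambda>Rs. Rs @ [S]) ` ?W k R {S}))" by (rule card_UN_le[OF J])
  also have "\<dots> \<le> (\<Sum>R\<in>?J. card (?W k R {S}))" by (intro sum_mono card_image_le finW)
  finally have "real (card (?W (Suc k) S X)) \<le> (\<Sum>R\<in>?J. real (card (?W k R {S})))"
    by (simp flip: of_nat_sum)
  also have "\<dots> \<le> (\<Sum>R\<in>?J. walks G E k R {S})" by (intro sum_mono Suc.IH)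
  finally show ?case by simp
qed

definition total_walks :: "(nat \<Rightarrow> 'a \<Rightarrow> 'a \<Rightarrow> bool) \<Rightarrow> 'a set \<Rightarrow> nat \<Rightarrow> real" where
  "total_walks G E k = (\<Sum>S\<in>E. walks G E k S {})"

lemma card_walk_lists:
  assumes fin: "finite E"
  shows "real (card (walk_lists G E k)) \<le> total_walks G E k"
proof -
  have "walk_lists G E k \<subseteq> (\<Union>S\<in>E. {Rs \<in> walk_lists G E k. Rs ! k = S})"
  proof
    fix Rs assume Rs: "Rs \<in> walk_lists G E k"
    then have "Rs ! k \<in> E" by (auto simp: walk_lists_def intro: subsetD[OF _ nth_mem])
    then show "Rs \<in> (\<Union>S\<in>E. {Rs \<in> walk_lists G E k. Rs ! k = S})" using Rs by blast
  qed
  then have "card (walk_lists G E k) \<le> card (\<Union>S\<in>E. {Rs \<in> walk_lists G E k. Rs ! k = S})"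
    using fin finite_walk_lists[OF fin] by (intro card_mono) auto
  also have "\<dots> \<le> (\<Sum>S\<in>E. card {Rs \<in> walk_lists G E k. Rs ! k = S})" by (rule card_UN_le[OF fin])
  finally have "real (card (walk_lists G E k)) \<le> (\<Sum>S\<in>E. real (card {Rs \<in> walk_lists G E k. Rs ! k = S}))"
    by (simp flip: of_nat_sum)
  also have "\<dots> \<le> (\<Sum>S\<in>E. walks G E k S {})"
    using card_walk_lists_ending[OF fin, where X = "{}"] by (intro sum_mono) simp
  finally show ?thesis by (simp add: total_walks_def)
qed

section \<open>Pushing weights along an incidence relation\<close>

abbreviation cbrt_card :: "'a set \<Rightarrow> real" where
  "cbrt_card A \<equiv> root 3 (real (card A))"

text \<open>
  The dual form of the weak \<open>L\<^sup>3\<close> norm.  It is additive in \<open>g\<close>, and testing on sets is what an incidence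
  bound for sets can exploit without a logarithmic loss.
\<close>

definition weak_bound :: "'a set \<Rightarrow> real \<Rightarrow> ('a \<Rightarrow> real) \<Rightarrow> bool" where
  "weak_bound E \<kappa> g \<longleftrightarrow> (\<forall>A\<subseteq>E. sum g A \<le> \<kappa> * (cbrt_card A)\<^sup>2)"

text \<open>
  The growth of the bounds in one step of \<open>walks_decomposition\<close>: the constant of \<open>push_split\<close>, and \<open>1\<close> for the
  constant weight that joins the regular part.
\<close>

definition step_factor :: "real \<Rightarrow> real" where
  "step_factor K = 120 * K\<^sup>2 + 1"

text \<open>
  The two summands come from the two parts of \<open>total_walks_step\<close>.
\<close>

definition chain_factor :: "real \<Rightarrow> real" where
  "chain_factor K = 81 * K ^ 4 + 2 * step_factor K"

text \<open>
  The lower bound on the size of \<open>E\<close> says that \<open>2 K \<le> sqrt n\<close>, so that the bound for points of high degree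
  is available at the threshold \<open>sqrt n\<close>.
\<close>

locale incidence_system =
  fixes E :: "'a set" and G :: "nat \<Rightarrow> 'a \<Rightarrow> 'a \<Rightarrow> bool" and K :: real
  assumes finite_E: "finite E"
    and K_ge_1: "K \<ge> 1"
    and large: "(2 * K)\<^sup>2 \<le> real (card E)"
    and incidences: "X \<subseteq> E \<Longrightarrow> Y \<subseteq> E \<Longrightarrow> real (\<Sum>x\<in>X. card {y \<in> Y. G i x y})
          \<le> K * ((cbrt_card X)\<^sup>2 * (cbrt_card Y)\<^sup>2 + real (card X) + real (card Y))"
    and unique_midpoint: "P \<in> E \<Longrightarrow> Q \<in> E \<Longrightarrow> P \<noteq> Q \<Longrightarrow> R \<in> E \<Longrightarrow> R' \<in> E \<Longrightarrow>
          G i P R \<Longrightarrow> G (Suc i) R Q \<Longrightarrow> G i P R' \<Longrightarrow> G (Suc i) R' Q \<Longrightarrow> R = R'"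
begin

definition deg :: "nat \<Rightarrow> 'a set \<Rightarrow> 'a \<Rightarrow> nat" where
  "deg i A S = card {Q \<in> A. G i S Q}"

definition push :: "nat \<Rightarrow> ('a \<Rightarrow> real) \<Rightarrow> 'a \<Rightarrow> real" where
  "push i g Q = (\<Sum>S | S \<in> E \<and> G i S Q. g S)"

abbreviation N :: real where "N \<equiv> cbrt_card E"

lemma cbrt_cube: "(cbrt_card A) ^ 3 = real (card A)" by simp

lemma N_ge_1: "N \<ge> 1"
proof -
  have "1 \<le> (2 * K)\<^sup>2" using K_ge_1 by (intro one_le_power) simp
  then show ?thesis using large by simp
qed

lemma N_pos: "N > 0" using N_ge_1 by linarith

lemma cbrt_card_mono: "A \<subseteq> B \<Longrightarrow> B \<subseteq> E \<Longrightarrow> cbrt_card A \<le> cbrt_card B"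
  using finite_E by (simp add: card_mono finite_subset)

lemma sum_push:
  assumes "A \<subseteq> E"
  shows "(\<Sum>Q\<in>A. push i g Q) = (\<Sum>S\<in>E. g S * deg i A S)"
proof -
  have "(\<Sum>Q\<in>A. push i g Q) = (\<Sum>S\<in>E. \<Sum>Q | Q \<in> A \<and> G i S Q. g S)"
    unfolding push_def using assms finite_E finite_subset by (intro sum.swap_restrict) auto
  then show ?thesis by (simp add: deg_def mult.commute)
qed

lemma push_nonneg: "(\<And>S. S \<in> E \<Longrightarrow> g S \<ge> 0) \<Longrightarrow> push i g Q \<ge> 0"
  by (auto simp: push_def intro: sum_nonneg)

text \<open>
  Points of degree at least \<open>r\<close> into \<open>A\<close>.  If \<open>r \<ge> 2 K\<close>, the term \<open>K |B|\<close> of the incidence bound is absorbed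
  by \<open>r |B|\<close>, and the alternatives of the conclusion correspond to the term that dominates among the other two.
\<close>

lemma rich_points:
  assumes AB: "A \<subseteq> E" "B \<subseteq> E" and r: "2 * K \<le> r" and rich: "\<And>S. S \<in> B \<Longrightarrow> r \<le> deg i A S"
  shows "cbrt_card B \<le> 4 * K * (cbrt_card A)\<^sup>2 / r \<or> real (card B) \<le> 4 * K * card A / r"
proof -
  define a b where "a = cbrt_card A" and "b = cbrt_card B"
  have ab: "a \<ge> 0" "b \<ge> 0" "a ^ 3 = card A" "b ^ 3 = card B" by (simp_all add: a_def b_def)
  have r0: "r > 0" using r K_ge_1 by linarith
  have "r * card B = (\<Sum>S\<in>B. r)" by simp
  also have "\<dots> \<le> (\<Sum>S\<in>B. real (deg i A S))" by (intro sum_mono rich)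
  also have "\<dots> \<le> K * (b\<^sup>2 * a\<^sup>2 + card B + card A)"
    using incidences[OF AB(2,1), of i] by (simp add: deg_def a_def b_def)
  finally have "r * b ^ 3 \<le> K * (b\<^sup>2 * a\<^sup>2 + b ^ 3 + a ^ 3)" using ab by simp
  moreover have "2 * K * b ^ 3 \<le> r * b ^ 3" using r ab by (intro mult_right_mono) auto
  ultimately have main: "r * b ^ 3 \<le> 2 * K * (b\<^sup>2 * a\<^sup>2 + a ^ 3)" by (simp add: algebra_simps)
  show ?thesis
  proof (cases "a ^ 3 \<le> b\<^sup>2 * a\<^sup>2")
    case True
    have "b \<le> 4 * K * a\<^sup>2 / r"
    proof (cases "b = 0")
      case True
      then show ?thesis using ab r0 K_ge_1 by simp
    next
      case False
      then have b: "b\<^sup>2 > 0" by simp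
      have "2 * K * (b\<^sup>2 * a\<^sup>2 + a ^ 3) \<le> 2 * K * (b\<^sup>2 * a\<^sup>2 + b\<^sup>2 * a\<^sup>2)"
        using True K_ge_1 by (intro mult_left_mono add_left_mono) auto
      then have "b\<^sup>2 * (r * b) \<le> b\<^sup>2 * (4 * K * a\<^sup>2)"
        using main by (simp add: power3_eq_cube power2_eq_square algebra_simps)
      then have "r * b \<le> 4 * K * a\<^sup>2" using b by (rule mult_left_le_imp_le)
      then show ?thesis using r0 by (simp add: field_simps)
    qed
    then show ?thesis by (simp add: a_def b_def)
  next
    case False
    then have "2 * K * (b\<^sup>2 * a\<^sup>2 + a ^ 3) \<le> 2 * K * (a ^ 3 + a ^ 3)"
      using K_ge_1 by (intro mult_left_mono) auto
    then have "r * b ^ 3 \<le> 4 * K * a ^ 3" using main by simp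
    then show ?thesis using r0 ab by (simp add: field_simps)
  qed
qed

text \<open>
  The form of \<open>rich_points\<close> that is summed over \<open>r\<close>: the first summand is cut off at \<open>N\<^sup>2\<close>
  so that its sum is of order \<open>N\<^sup>2 + N (cbrt_card A)\<^sup>2\<close>, and the second has the sum of \<open>r^(-2/3)\<close> as a factor.
\<close>

lemma rich_points_two_thirds:
  assumes AB: "A \<subseteq> E" "B \<subseteq> E" and r: "2 * K \<le> r" and rich: "\<And>S. S \<in> B \<Longrightarrow> r \<le> deg i A S"
  shows "(cbrt_card B)\<^sup>2 \<le> min (N\<^sup>2) ((4 * K * (cbrt_card A)\<^sup>2 / r)\<^sup>2)
                          + 16 * K\<^sup>2 * (cbrt_card A)\<^sup>2 * (1 / (root 3 r)\<^sup>2)"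
proof -
  have r0: "r > 0" using r K_ge_1 by linarith
  have BN: "(cbrt_card B)\<^sup>2 \<le> N\<^sup>2" using cbrt_card_mono[OF AB(2)] by (intro power_mono) auto
  have pos: "16 * K\<^sup>2 * (cbrt_card A)\<^sup>2 * (1 / (root 3 r)\<^sup>2) \<ge> 0" by simp
  from rich_points[OF assms] show ?thesis
  proof
    assume "cbrt_card B \<le> 4 * K * (cbrt_card A)\<^sup>2 / r"
    then have "(cbrt_card B)\<^sup>2 \<le> (4 * K * (cbrt_card A)\<^sup>2 / r)\<^sup>2" by (intro power_mono) auto
    then show ?thesis using BN pos by linarith
  next
    assume "real (card B) \<le> 4 * K * card A / r"
    then have "cbrt_card B \<le> root 3 (4 * K * card A / r)" by simp
    then have "(cbrt_card B)\<^sup>2 \<le> (root 3 (4 * K * card A / r))\<^sup>2" by (intro power_mono) auto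
    also have "\<dots> = (root 3 (4 * K))\<^sup>2 * ((cbrt_card A)\<^sup>2 * (1 / (root 3 r)\<^sup>2))"
      by (simp add: real_root_mult real_root_divide power_divide power_mult_distrib)
    also have "\<dots> \<le> (4 * K)\<^sup>2 * ((cbrt_card A)\<^sup>2 * (1 / (root 3 r)\<^sup>2))"
    proof (intro mult_right_mono power_mono)
      have "4 * K \<le> (4 * K) ^ 3" using K_ge_1 by (intro self_le_power) auto
      then have "root 3 (4 * K) \<le> root 3 ((4 * K) ^ 3)" by simp
      also have "\<dots> = 4 * K" using K_ge_1 by (intro real_root_power_cancel) auto
      finally show "root 3 (4 * K) \<le> 4 * K" .
    qed (use K_ge_1 in auto)
    finally have "(cbrt_card B)\<^sup>2 \<le> 16 * K\<^sup>2 * (cbrt_card A)\<^sup>2 * (1 / (root 3 r)\<^sup>2)"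
      by (simp add: power_mult_distrib)
    moreover have "min (N\<^sup>2) ((4 * K * (cbrt_card A)\<^sup>2 / r)\<^sup>2) \<ge> 0" by simp
    ultimately show ?thesis by linarith
  qed
qed

text \<open>
  A layer-cake decomposition of the degrees into \<open>A\<close>: the weight on the left is the sum over \<open>r\<close> of the mass of \<open>g\<close> on
  \<open>{S. r \<le> deg i A S}\<close>, to which the weak bound applies.  The values \<open>r < 2 K\<close>, where nothing better than \<open>n\<close> is known
  about the number of points, produce the term \<open>N\<^sup>2\<close>; it dominates exactly when \<open>A\<close> has fewer than \<open>sqrt n\<close>
  points.
\<close>

lemma sum_push_le:
  assumes weak: "weak_bound E \<kappa> g" and \<kappa>: "\<kappa> \<ge> 0" and A: "A \<subseteq> E"
  shows "(\<Sum>Q\<in>A. push i g Q) \<le> 60 * K\<^sup>2 * \<kappa> * (N * (cbrt_card A)\<^sup>2 + N\<^sup>2)"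
proof -
  let ?n = "card E"
  define a where "a = cbrt_card A"
  have a: "a \<ge> 0" by (simp add: a_def)
  define B where "B r = {S \<in> E. r \<le> deg i A S}" for r
  have deg_le: "deg i A S \<le> ?n" for S
    unfolding deg_def by (rule card_mono[OF finite_E]) (use A in auto)
  have "(\<Sum>Q\<in>A. push i g Q) = (\<Sum>S\<in>E. g S * deg i A S)" by (rule sum_push[OF A])
  also have "\<dots> = (\<Sum>S\<in>E. \<Sum>r | r \<in> {1..?n} \<and> r \<le> deg i A S. g S)"
  proof (rule sum.cong)
    fix S
    have "{r. r \<in> {1..?n} \<and> r \<le> deg i A S} = {1..deg i A S}" using deg_le[of S] by auto
    then show "g S * deg i A S = (\<Sum>r | r \<in> {1..?n} \<and> r \<le> deg i A S. g S)" by simp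
  qed simp
  also have "\<dots> = (\<Sum>r=1..?n. \<Sum>S | S \<in> E \<and> r \<le> deg i A S. g S)"
    by (intro sum.swap_restrict finite_E) simp
  also have "\<dots> \<le> (\<Sum>r=1..?n. \<kappa> * (cbrt_card (B r))\<^sup>2)"
    using weak unfolding weak_bound_def by (intro sum_mono) (auto simp: B_def)
  also have "\<dots> = \<kappa> * (\<Sum>r=1..?n. (cbrt_card (B r))\<^sup>2)" by (simp only: sum_distrib_left)
  finally have layers: "(\<Sum>Q\<in>A. push i g Q) \<le> \<kappa> * (\<Sum>r=1..?n. (cbrt_card (B r))\<^sup>2)" .
  have "(\<Sum>r=1..?n. (cbrt_card (B r))\<^sup>2)
      \<le> (\<Sum>r=1..?n. (if real r < 2 * K then N\<^sup>2 else 0) + min (N\<^sup>2) ((4 * K * a\<^sup>2 / r)\<^sup>2)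
                          + 16 * K\<^sup>2 * a\<^sup>2 * (1 / (root 3 r)\<^sup>2))"
  proof (rule sum_mono)
    fix r :: nat
    show "(cbrt_card (B r))\<^sup>2 \<le> (if real r < 2 * K then N\<^sup>2 else 0) + min (N\<^sup>2) ((4 * K * a\<^sup>2 / r)\<^sup>2)
                          + 16 * K\<^sup>2 * a\<^sup>2 * (1 / (root 3 r)\<^sup>2)"
    proof (cases "real r < 2 * K")
      case True
      have "(cbrt_card (B r))\<^sup>2 \<le> N\<^sup>2" using cbrt_card_mono[of "B r" E] by (intro power_mono) (auto simp: B_def)
      moreover have "min (N\<^sup>2) ((4 * K * a\<^sup>2 / r)\<^sup>2) \<ge> 0" "16 * K\<^sup>2 * a\<^sup>2 * (1 / (root 3 r)\<^sup>2) \<ge> 0" by simp_all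
      ultimately show ?thesis unfolding if_P[OF True] by linarith
    next
      case False
      then show ?thesis
        using rich_points_two_thirds[OF A, of "B r" r i] by (auto simp: B_def a_def)
    qed
  qed
  also have "\<dots> = (\<Sum>r=1..?n. if real r < 2 * K then N\<^sup>2 else 0) + (\<Sum>r=1..?n. min (N\<^sup>2) ((4 * K * a\<^sup>2 / r)\<^sup>2))
                  + 16 * K\<^sup>2 * a\<^sup>2 * (\<Sum>r=1..?n. 1 / (root 3 r)\<^sup>2)"
    by (simp only: sum.distrib sum_distrib_left)
  also have "\<dots> \<le> 2 * K * N\<^sup>2 + (N\<^sup>2 + 2 * N * (4 * K * a\<^sup>2)) + 16 * K\<^sup>2 * a\<^sup>2 * (3 * N)"
  proof (intro add_mono)
    have "(\<Sum>r=1..?n. if real r < 2 * K then N\<^sup>2 else 0) = (\<Sum>r | r \<in> {1..?n} \<and> real r < 2 * K. N\<^sup>2)"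
      by (subst sum.inter_filter) auto
    also have "\<dots> \<le> (\<Sum>r\<in>{1..nat \<lfloor>2 * K\<rfloor>}. N\<^sup>2)"
      by (rule sum_mono2) (auto simp: le_nat_floor)
    also have "\<dots> \<le> 2 * K * N\<^sup>2" using K_ge_1 by (simp add: mult_right_mono)
    finally show "(\<Sum>r=1..?n. if real r < 2 * K then N\<^sup>2 else 0) \<le> 2 * K * N\<^sup>2" .
    show "(\<Sum>r=1..?n. min (N\<^sup>2) ((4 * K * a\<^sup>2 / r)\<^sup>2)) \<le> N\<^sup>2 + 2 * N * (4 * K * a\<^sup>2)"
      using K_ge_1 a N_pos by (intro sum_min_inverse_squares) auto
    show "16 * K\<^sup>2 * a\<^sup>2 * (\<Sum>r=1..?n. 1 / (root 3 r)\<^sup>2) \<le> 16 * K\<^sup>2 * a\<^sup>2 * (3 * N)"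
      by (intro mult_left_mono sum_inverse_two_thirds) simp
  qed
  also have "\<dots> = (2 * K + 1) * N\<^sup>2 + (8 * K + 48 * K\<^sup>2) * (N * a\<^sup>2)" by (simp add: algebra_simps)
  also have "\<dots> \<le> 60 * K\<^sup>2 * N\<^sup>2 + 60 * K\<^sup>2 * (N * a\<^sup>2)"
  proof -
    have "K \<le> K\<^sup>2" "1 \<le> K\<^sup>2" using K_ge_1 by (auto simp: self_le_power)
    then show ?thesis using N_pos by (intro add_mono mult_right_mono) auto
  qed
  finally have "\<kappa> * (\<Sum>r=1..?n. (cbrt_card (B r))\<^sup>2) \<le> \<kappa> * (60 * K\<^sup>2 * N\<^sup>2 + 60 * K\<^sup>2 * (N * a\<^sup>2))"
    using \<kappa> by (rule mult_left_mono)
  with layers show ?thesis by (simp add: a_def algebra_simps)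
qed

text \<open>
  The threshold \<open>2 L s\<close> is chosen so that, by \<open>sum_push_le\<close>, at most \<open>sqrt n = s\<^sup>3\<close> points exceed it.
  Their total mass is then governed by the term \<open>N\<^sup>2\<close> of that bound.  On the other points a set of more than
  \<open>sqrt n\<close> points is handled by \<open>sum_push_le\<close>, and a smaller one by the threshold.
\<close>

lemma push_split:
  assumes weak: "weak_bound E \<kappa> g" and nonneg: "\<And>S. S \<in> E \<Longrightarrow> g S \<ge> 0" and \<kappa>: "\<kappa> > 0"
  obtains g' h' where "\<And>Q. g' Q \<ge> 0" "\<And>Q. h' Q \<ge> 0" "\<And>Q. push i g Q = g' Q + h' Q"
    "weak_bound E (120 * K\<^sup>2 * \<kappa> * N) g'" "sum h' E \<le> 120 * K\<^sup>2 * \<kappa> * N\<^sup>2"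
proof -
  define L where "L = 60 * K\<^sup>2 * \<kappa>"
  have L: "L > 0" using K_ge_1 \<kappa> by (simp add: L_def)
  define s where "s = sqrt N"
  have s: "s > 0" "N = s\<^sup>2" using N_pos by (simp_all add: s_def)
  define H where "H = {Q \<in> E. push i g Q > 2 * L * s}"
  have HE: "H \<subseteq> E" by (auto simp: H_def)
  have pushle: "(\<Sum>Q\<in>A. push i g Q) \<le> L * (s\<^sup>2 * (cbrt_card A)\<^sup>2 + (s\<^sup>2)\<^sup>2)" if "A \<subseteq> E" for A
    using sum_push_le[OF weak _ that, of i] \<kappa> s by (simp add: L_def)
  have push0: "push i g Q \<ge> 0" for Q using push_nonneg nonneg by blast
  have square_le: "(s\<^sup>2)\<^sup>2 \<le> s\<^sup>2 * a\<^sup>2" if "s \<le> a" for a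
    unfolding power2_eq_square[of "s\<^sup>2"] using that s by (intro mult_left_mono power_mono) auto
  have "cbrt_card H \<le> s"
  proof (rule ccontr)
    assume "\<not> ?thesis"
    then have h: "s < cbrt_card H" by simp
    define h where "h = cbrt_card H"
    have "2 * L * s * h ^ 3 = (\<Sum>Q\<in>H. 2 * L * s)" by (simp add: h_def)
    also have "\<dots> \<le> (\<Sum>Q\<in>H. push i g Q)" by (intro sum_mono) (auto simp: H_def)
    also have "\<dots> \<le> L * (s\<^sup>2 * h\<^sup>2 + (s\<^sup>2)\<^sup>2)" using pushle[OF HE] by (simp add: h_def)
    also have "\<dots> \<le> L * (s\<^sup>2 * h\<^sup>2 + s\<^sup>2 * h\<^sup>2)"
      using square_le[of h] h L by (intro mult_left_mono) (auto simp: h_def)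
    finally have "(2 * L * s * h\<^sup>2) * h \<le> (2 * L * s * h\<^sup>2) * s"
      by (simp add: power2_eq_square power3_eq_cube algebra_simps)
    moreover have "h > 0" using h s unfolding h_def by linarith
    then have "2 * L * s * h\<^sup>2 > 0" using L s by simp
    ultimately have "h \<le> s" by (rule mult_left_le_imp_le)
    then show False using h by (simp add: h_def)
  qed
  then have H2: "(cbrt_card H)\<^sup>2 \<le> s\<^sup>2" by (intro power_mono) auto
  define g' where "g' Q = (if Q \<in> H then 0 else push i g Q)" for Q
  define h' where "h' Q = (if Q \<in> H then push i g Q else 0)" for Q
  show thesis
  proof (rule that[of g' h'])
    show "g' Q \<ge> 0" "h' Q \<ge> 0" "push i g Q = g' Q + h' Q" for Q
      using push0 by (auto simp: g'_def h'_def)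
    have "sum h' E = (\<Sum>Q\<in>H. push i g Q)"
      unfolding h'_def using HE finite_E by (simp add: sum.inter_restrict[symmetric] Int_absorb1)
    also have "\<dots> \<le> L * (s\<^sup>2 * (cbrt_card H)\<^sup>2 + (s\<^sup>2)\<^sup>2)" by (rule pushle[OF HE])
    also have "\<dots> \<le> L * (s\<^sup>2 * s\<^sup>2 + (s\<^sup>2)\<^sup>2)"
      using L by (intro mult_left_mono add_right_mono H2) auto
    finally show "sum h' E \<le> 120 * K\<^sup>2 * \<kappa> * N\<^sup>2" by (simp add: L_def s power2_eq_square)
    show "weak_bound E (120 * K\<^sup>2 * \<kappa> * N) g'"
      unfolding weak_bound_def
    proof (intro allI impI)
      fix A assume A: "A \<subseteq> E"
      define a where "a = cbrt_card A"
      have "sum g' A \<le> 2 * L * (s\<^sup>2 * a\<^sup>2)"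
      proof (cases "a \<le> s")
        case True
        have "sum g' A \<le> (\<Sum>Q\<in>A. 2 * L * s)"
          using A L s by (intro sum_mono) (auto simp: g'_def H_def not_less)
        also have "\<dots> = 2 * L * s * a ^ 3" by (simp add: a_def)
        also have "\<dots> = 2 * L * s * a\<^sup>2 * a" by (simp add: power2_eq_square power3_eq_cube)
        also have "\<dots> \<le> 2 * L * s * a\<^sup>2 * s" using True L s by (intro mult_left_mono) auto
        finally show ?thesis by (simp add: power2_eq_square algebra_simps)
      next
        case False
        have "sum g' A \<le> (\<Sum>Q\<in>A. push i g Q)" using push0 by (intro sum_mono) (auto simp: g'_def)
        also have "\<dots> \<le> L * (s\<^sup>2 * a\<^sup>2 + (s\<^sup>2)\<^sup>2)" using pushle[OF A] by (simp add: a_def)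
        also have "\<dots> \<le> L * (s\<^sup>2 * a\<^sup>2 + s\<^sup>2 * a\<^sup>2)"
          using square_le[of a] False L by (intro mult_left_mono add_left_mono) auto
        finally show ?thesis by (simp add: mult_ac)
      qed
      then show "sum g' A \<le> 120 * K\<^sup>2 * \<kappa> * N * (cbrt_card A)\<^sup>2"
        by (simp add: L_def a_def s(2) algebra_simps)
    qed
  qed
qed

section \<open>Growth of the number of walks\<close>

text \<open>
  A two-step path from \<open>R\<close> to \<open>Q\<close> has at most one midpoint, so each weight \<open>w R\<close> is counted at most once.
  This fails for \<open>R = Q\<close>, which is why immediate returns have to be excluded.
\<close>

lemma two_step_sum:
  assumes w: "\<And>R. R \<in> E \<Longrightarrow> w R \<ge> (0::real)" and Q: "Q \<in> E"
  shows "(\<Sum>S | S \<in> E \<and> G (Suc i) S Q. \<Sum>R | R \<in> E - {Q} \<and> G i R S. w R) \<le> sum w E"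
proof -
  let ?S = "{S \<in> E. G (Suc i) S Q}"
  have "(\<Sum>S\<in>?S. \<Sum>R | R \<in> E - {Q} \<and> G i R S. w R) = (\<Sum>R\<in>E - {Q}. \<Sum>S | S \<in> ?S \<and> G i R S. w R)"
    using finite_E by (intro sum.swap_restrict) auto
  also have "\<dots> = (\<Sum>R\<in>E - {Q}. card {S \<in> ?S. G i R S} * w R)" by simp
  also have "\<dots> \<le> (\<Sum>R\<in>E - {Q}. 1 * w R)"
  proof (intro sum_mono mult_right_mono)
    fix R assume R: "R \<in> E - {Q}"
    have "S = S'" if "S \<in> {S \<in> ?S. G i R S}" "S' \<in> {S \<in> ?S. G i R S}" for S S'
      using unique_midpoint[of R Q S S' i] R Q that by simp
    then have "card {S \<in> ?S. G i R S} \<le> 1" using finite_E by (subst card_le_Suc0_iff_eq[folded One_nat_def]) auto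
    then show "real (card {S \<in> ?S. G i R S}) \<le> 1" by simp
  qed (use w in auto)
  also have "\<dots> \<le> sum w E" using w finite_E by (auto intro: sum_mono2)
  finally show ?thesis by simp
qed

abbreviation c :: real where "c \<equiv> step_factor K"

lemma c_ge_1: "c \<ge> 1" by (simp add: step_factor_def)

text \<open>
  The weights of the walks ending at \<open>S\<close> split into a regular part \<open>g\<close>, a part \<open>h\<close> of small mass on star
  centres, and a part \<open>t\<close> for the walks that left a star centre in the last step.  Nothing pointwise is known about
  \<open>t\<close>, but its sum in the next step is bounded: there \<open>two_step_sum\<close> turns the mass of the previous \<open>h\<close> into a bound by a constant,
  which joins \<open>g\<close>.
\<close>

lemma walks_decomposition:
  "\<exists>g h t. (\<forall>S. 0 \<le> g S) \<and> (\<forall>S. 0 \<le> h S) \<and> (\<forall>S Q. 0 \<le> t S Q) \<and>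
     weak_bound E (c ^ i * N ^ (i + 1)) g \<and>
     sum h E \<le> c ^ i * N ^ (i + 2) \<and>
     (\<forall>Q\<in>E. (\<Sum>S | S \<in> E \<and> G i S Q. t S Q) \<le> c ^ i * N ^ (i + 1)) \<and>
     (\<forall>S\<in>E. \<forall>Q\<in>E. walks G E i S {Q} \<le> g S + h S + (t S Q :: real))"
proof (induction i)
  case 0
  have "real (card A) \<le> N * (cbrt_card A)\<^sup>2" if "A \<subseteq> E" for A
  proof -
    have "real (card A) = cbrt_card A * (cbrt_card A)\<^sup>2"
      using cbrt_cube[of A] by (simp add: power2_eq_square power3_eq_cube)
    also have "\<dots> \<le> N * (cbrt_card A)\<^sup>2" using cbrt_card_mono[OF that] by (intro mult_right_mono) auto
    finally show ?thesis .
  qed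
  then have "weak_bound E N (\<lambda>_. 1)" by (simp add: weak_bound_def)
  then show ?case
    using N_pos by (intro exI[of _ "\<lambda>_. 1"] exI[of _ "\<lambda>_. 0"] exI[of _ "\<lambda>_ _. 0"]) simp
next
  case (Suc i)
  then obtain g h t where nonneg: "\<And>S. 0 \<le> g S" "\<And>S. 0 \<le> h S" "\<And>S Q. 0 \<le> t S Q"
    and g: "weak_bound E (c ^ i * N ^ (i + 1)) g" and h: "sum h E \<le> c ^ i * N ^ (i + 2)"
    and t: "\<And>Q. Q \<in> E \<Longrightarrow> (\<Sum>S | S \<in> E \<and> G i S Q. t S Q) \<le> c ^ i * N ^ (i + 1)"
    and walks: "\<And>S Q. S \<in> E \<Longrightarrow> Q \<in> E \<Longrightarrow> walks G E i S {Q} \<le> g S + h S + t S Q"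
    by blast
  define \<kappa> where "\<kappa> = c ^ i * N ^ (i + 1)"
  have \<kappa>: "\<kappa> > 0" using c_ge_1 N_pos by (simp add: \<kappa>_def)
  obtain g' h' where gh: "\<And>Q. g' Q \<ge> 0" "\<And>Q. h' Q \<ge> 0" "\<And>Q. push i g Q = g' Q + h' Q"
    "weak_bound E (120 * K\<^sup>2 * \<kappa> * N) g'" "sum h' E \<le> 120 * K\<^sup>2 * \<kappa> * N\<^sup>2"
    using push_split[OF g nonneg(1)] \<kappa> unfolding \<kappa>_def by metis
  define g'' where "g'' Q = g' Q + \<kappa>" for Q
  define t' where "t' Q Z = (\<Sum>S | S \<in> E - {Z} \<and> G i S Q. h S)" for Q Z
  have "weak_bound E (c ^ Suc i * N ^ (Suc i + 1)) g''"
    unfolding weak_bound_def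
  proof (intro allI impI)
    fix A assume A: "A \<subseteq> E"
    have "sum g'' A = sum g' A + \<kappa> * (cbrt_card A) ^ 3" by (simp add: g''_def sum.distrib)
    also have "\<dots> \<le> 120 * K\<^sup>2 * \<kappa> * N * (cbrt_card A)\<^sup>2 + \<kappa> * (N * (cbrt_card A)\<^sup>2)"
    proof (intro add_mono mult_left_mono)
      show "sum g' A \<le> 120 * K\<^sup>2 * \<kappa> * N * (cbrt_card A)\<^sup>2" using gh(4) A by (simp add: weak_bound_def)
      have "(cbrt_card A) ^ 3 = cbrt_card A * (cbrt_card A)\<^sup>2" by (simp only: power3_eq_cube power2_eq_square mult.assoc)
      also have "\<dots> \<le> N * (cbrt_card A)\<^sup>2" using cbrt_card_mono[OF A] by (intro mult_right_mono) auto
      finally show "(cbrt_card A) ^ 3 \<le> N * (cbrt_card A)\<^sup>2" .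
    qed (use \<kappa> in simp)
    also have "\<dots> = c ^ Suc i * N ^ (Suc i + 1) * (cbrt_card A)\<^sup>2"
      by (simp add: step_factor_def \<kappa>_def algebra_simps)
    finally show "sum g'' A \<le> c ^ Suc i * N ^ (Suc i + 1) * (cbrt_card A)\<^sup>2" .
  qed
  moreover have "sum h' E \<le> c ^ Suc i * N ^ (Suc i + 2)"
  proof -
    have "120 * K\<^sup>2 * (\<kappa> * N\<^sup>2) \<le> c * (\<kappa> * N\<^sup>2)" using \<kappa> by (intro mult_right_mono) (auto simp: step_factor_def)
    also have "\<dots> = c ^ Suc i * N ^ (Suc i + 2)" by (simp add: \<kappa>_def power2_eq_square)
    finally show ?thesis using gh(5) by (simp add: mult.assoc)
  qed
  moreover have "(\<Sum>Q | Q \<in> E \<and> G (Suc i) Q Z. t' Q Z) \<le> c ^ Suc i * N ^ (Suc i + 1)" if Z: "Z \<in> E" for Z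
  proof -
    have "(\<Sum>Q | Q \<in> E \<and> G (Suc i) Q Z. t' Q Z) \<le> sum h E"
      unfolding t'_def by (rule two_step_sum) (use nonneg Z in auto)
    also have "\<dots> \<le> 1 * (c ^ i * N ^ (i + 2))" using h by simp
    also have "\<dots> \<le> c * (c ^ i * N ^ (i + 2))"
      using c_ge_1 N_pos by (intro mult_right_mono) auto
    finally show ?thesis by (simp add: mult.assoc)
  qed
  moreover have "walks G E (Suc i) Q {Z} \<le> g'' Q + h' Q + t' Q Z" if QZ: "Q \<in> E" "Z \<in> E" for Q Z
  proof -
    let ?J = "{S. S \<in> E - {Z} \<and> G i S Q}"
    have sub: "?J \<subseteq> {S. S \<in> E \<and> G i S Q}" by auto
    have "walks G E (Suc i) Q {Z} \<le> (\<Sum>S\<in>?J. g S + h S + t S Q)"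
      unfolding walks.simps using walks QZ by (intro sum_mono) auto
    also have "\<dots> = (\<Sum>S\<in>?J. g S) + t' Q Z + (\<Sum>S\<in>?J. t S Q)" by (simp add: sum.distrib t'_def)
    also have "(\<Sum>S\<in>?J. g S) \<le> push i g Q"
      unfolding push_def using finite_E nonneg by (intro sum_mono2 sub) auto
    also have "(\<Sum>S\<in>?J. t S Q) \<le> (\<Sum>S | S \<in> E \<and> G i S Q. t S Q)"
      using finite_E nonneg by (intro sum_mono2 sub) auto
    also have "\<dots> \<le> \<kappa>" using t QZ by (simp add: \<kappa>_def)
    finally show ?thesis by (simp add: gh(3) g''_def)
  qed
  moreover have "g'' Q \<ge> 0" "t' Q Z \<ge> 0" for Q Z
    using gh \<kappa> nonneg by (auto simp: g''_def t'_def intro: sum_nonneg add_nonneg_nonneg)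
  ultimately show ?case using gh(2) by (intro exI[of _ g''] exI[of _ h'] exI[of _ t']) blast
qed

text \<open>
  If the last point is given, the last but one is determined by the point before it.
\<close>

lemma walks_le_total:
  assumes Q: "Q \<in> E"
  shows "walks G E (Suc (Suc i)) Q {} \<le> total_walks G E i"
proof -
  have "walks G E (Suc (Suc i)) Q {} = (\<Sum>S | S \<in> E \<and> G (Suc i) S Q. \<Sum>R | R \<in> E - {Q} \<and> G i R S. walks G E i R {S})"
    by simp
  also have "\<dots> \<le> (\<Sum>S | S \<in> E \<and> G (Suc i) S Q. \<Sum>R | R \<in> E - {Q} \<and> G i R S. walks G E i R {})"
    by (intro sum_mono walks_mono finite_E)
  also have "\<dots> \<le> total_walks G E i"
    unfolding total_walks_def by (rule two_step_sum[OF _ Q]) (rule walks_nonneg)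
  finally show ?thesis .
qed

text \<open>
  There are \<open>O(sqrt n)\<close> points of degree at least \<open>sqrt n\<close>, so the incidence bound for them is linear in \<open>n\<close>.
\<close>

lemma sum_large_degrees:
  "(\<Sum>S | S \<in> E \<and> sqrt (card E) \<le> deg j E S. real (deg j E S)) \<le> 81 * K ^ 4 * N ^ 3"
proof -
  define B where "B = {S \<in> E. sqrt (card E) \<le> deg j E S}"
  have BE: "B \<subseteq> E" by (auto simp: B_def)
  define b s where "b = cbrt_card B" and "s = sqrt N"
  have s: "s > 0" "N = s\<^sup>2" using N_pos by (simp_all add: s_def)
  have n: "real (card E) = s ^ 6" using cbrt_cube[of E] unfolding s(2) by (simp flip: power_mult)
  have sq: "sqrt (card E) = s ^ 3"
    unfolding n using s by (intro real_sqrt_unique) (auto simp flip: power_mult)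
  have r: "2 * K \<le> s ^ 3"
  proof -
    have "2 * K = sqrt ((2 * K)\<^sup>2)" using K_ge_1 by (simp only: real_sqrt_abs)
    also have "\<dots> \<le> sqrt (card E)" using large by simp
    finally show ?thesis using sq by simp
  qed
  have "b \<le> 4 * K * N\<^sup>2 / s ^ 3 \<or> real (card B) \<le> 4 * K * card E / s ^ 3"
    unfolding b_def by (rule rich_points[OF subset_refl BE r]) (auto simp: B_def sq)
  then have "b \<le> 4 * K * s"
  proof
    assume "b \<le> 4 * K * N\<^sup>2 / s ^ 3"
    also have "\<dots> = 4 * K * s" using s(1) unfolding s(2) by (simp add: field_simps eval_nat_numeral)
    finally show ?thesis .
  next
    assume "real (card B) \<le> 4 * K * card E / s ^ 3"
    also have "\<dots> = 4 * K * s ^ 3" using s(1) unfolding n by (simp add: field_simps eval_nat_numeral)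
    also have "\<dots> \<le> (4 * K) ^ 3 * s ^ 3"
      using K_ge_1 s by (intro mult_right_mono self_le_power) auto
    finally have "b ^ 3 \<le> (4 * K * s) ^ 3" by (simp add: b_def power_mult_distrib)
    then show ?thesis using K_ge_1 s by (intro power_le_imp_le_base[of b 2]) (auto simp: numeral_3_eq_3)
  qed
  have b0: "b \<ge> 0" by (simp add: b_def)
  have N3: "N ^ 3 = s ^ 6" unfolding s(2) by (simp flip: power_mult)
  have "1 \<le> s ^ 3" using r K_ge_1 by linarith
  then have s36: "s ^ 3 \<le> s ^ 6" using self_le_power[of "s ^ 3" 2] by (simp flip: power_mult)
  have "(\<Sum>S\<in>B. real (deg j E S)) \<le> K * (b\<^sup>2 * N\<^sup>2 + card B + card E)"
    using incidences[OF BE subset_refl, of j] by (simp add: deg_def b_def)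
  also have "\<dots> = K * (b\<^sup>2 * s ^ 4 + b ^ 3 + s ^ 6)"
  proof -
    have N2: "N\<^sup>2 = s ^ 4" unfolding s(2) by (simp flip: power_mult)
    have B3: "real (card B) = b ^ 3" by (simp add: b_def)
    show ?thesis by (simp only: N2 B3) (simp only: n)
  qed
  also have "\<dots> \<le> K * ((4 * K * s)\<^sup>2 * s ^ 4 + (4 * K * s) ^ 3 + s ^ 6)"
    using \<open>b \<le> 4 * K * s\<close> b0 K_ge_1 s by (intro mult_left_mono add_mono mult_right_mono power_mono) auto
  also have "\<dots> = 16 * K ^ 3 * s ^ 6 + 64 * K ^ 4 * s ^ 3 + K * s ^ 6"
    by (simp add: power_mult_distrib algebra_simps eval_nat_numeral)
  also have "\<dots> \<le> 16 * K ^ 4 * s ^ 6 + 64 * K ^ 4 * s ^ 6 + K ^ 4 * s ^ 6"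
  proof (intro add_mono)
    have "K ^ 3 \<le> K ^ 4" "K \<le> K ^ 4"
      using K_ge_1 by (auto intro: power_increasing self_le_power)
    then show "16 * K ^ 3 * s ^ 6 \<le> 16 * K ^ 4 * s ^ 6" "K * s ^ 6 \<le> K ^ 4 * s ^ 6"
      using s by (simp_all add: mult_right_mono)
    show "64 * K ^ 4 * s ^ 3 \<le> 64 * K ^ 4 * s ^ 6" using s36 by (intro mult_left_mono) auto
  qed
  also have "\<dots> = 81 * K ^ 4 * N ^ 3" unfolding N3 by simp
  finally show ?thesis by (simp add: B_def)
qed

text \<open>
  The last step is split according to the forward degree of the last but one point.  Large degrees add up to
  \<open>O(n)\<close>, which leaves the factor \<open>M\<close>; for degrees below \<open>sqrt n \<le> N\<^sup>2\<close> each part of the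
  decomposition contributes at the generic rate.
\<close>

lemma total_walks_step:
  assumes M: "\<And>S. S \<in> E \<Longrightarrow> walks G E j S {} \<le> M" "M \<ge> 0"
  shows "total_walks G E (Suc j) \<le> 81 * K ^ 4 * N ^ 3 * M + 2 * c ^ Suc j * N ^ (j + 4)"
proof -
  obtain g h t where nonneg: "\<And>S. 0 \<le> g S" "\<And>S. 0 \<le> h S" "\<And>S Q. 0 \<le> t S Q"
    and g: "weak_bound E (c ^ j * N ^ (j + 1)) g" and h: "sum h E \<le> c ^ j * N ^ (j + 2)"
    and t: "\<And>Q. Q \<in> E \<Longrightarrow> (\<Sum>S | S \<in> E \<and> G j S Q. t S Q) \<le> c ^ j * N ^ (j + 1)"
    and walks: "\<And>S Q. S \<in> E \<Longrightarrow> Q \<in> E \<Longrightarrow> walks G E j S {Q} \<le> g S + h S + t S Q"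
    using walks_decomposition[of j] by blast
  define \<kappa> where "\<kappa> = c ^ j * N ^ (j + 1)"
  have \<kappa>: "\<kappa> > 0" using c_ge_1 N_pos by (simp add: \<kappa>_def)
  define B where "B = {S \<in> E. sqrt (card E) \<le> deg j E S}"
  have BE: "B \<subseteq> E" by (auto simp: B_def)
  let ?T = "\<lambda>S. \<Sum>Q | Q \<in> E \<and> G j S Q. walks G E j S {Q}"
  have "total_walks G E (Suc j) = (\<Sum>Q\<in>E. \<Sum>S | S \<in> E \<and> G j S Q. walks G E j S {Q})"
    by (simp add: total_walks_def)
  also have "\<dots> = (\<Sum>S\<in>E. ?T S)" by (intro sum.swap_restrict finite_E)
  also have "\<dots> = (\<Sum>S\<in>E - B. ?T S) + (\<Sum>S\<in>B. ?T S)" by (rule sum.subset_diff[OF BE finite_E])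
  also have "(\<Sum>S\<in>B. ?T S) \<le> (\<Sum>S\<in>B. deg j E S * M)"
  proof (rule sum_mono)
    fix S assume "S \<in> B"
    then have "?T S \<le> (\<Sum>Q | Q \<in> E \<and> G j S Q. M)"
      using BE M(1) walks_mono[OF finite_E, of G j S] by (intro sum_mono) (meson order_trans subsetD)
    then show "?T S \<le> deg j E S * M" by (simp add: deg_def)
  qed
  also have "\<dots> = (\<Sum>S\<in>B. real (deg j E S)) * M" by (simp only: sum_distrib_right)
  also have "\<dots> \<le> 81 * K ^ 4 * N ^ 3 * M"
    using sum_large_degrees[of j] M(2) by (intro mult_right_mono) (auto simp: B_def)
  also have "(\<Sum>S\<in>E - B. ?T S) \<le> 2 * c ^ Suc j * N ^ (j + 4)"
  proof -
    have "(\<Sum>S\<in>E - B. ?T S) \<le> (\<Sum>S\<in>E - B. \<Sum>Q | Q \<in> E \<and> G j S Q. g S + h S + t S Q)"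
      using walks by (intro sum_mono) auto
    also have "\<dots> = (\<Sum>S\<in>E - B. g S * deg j E S) + (\<Sum>S\<in>E - B. h S * deg j E S)
                    + (\<Sum>S\<in>E - B. \<Sum>Q | Q \<in> E \<and> G j S Q. t S Q)"
      by (simp add: sum.distrib deg_def algebra_simps)
    also have "(\<Sum>S\<in>E - B. g S * deg j E S) \<le> (\<Sum>S\<in>E. g S * deg j E S)"
      using finite_E nonneg by (intro sum_mono2) auto
    also have "\<dots> \<le> 60 * K\<^sup>2 * \<kappa> * (N * N\<^sup>2 + N\<^sup>2)"
      using sum_push_le[OF g _ subset_refl, of j] \<kappa> sum_push[OF subset_refl, of j g]
      by (simp add: \<kappa>_def)
    also have "(\<Sum>S\<in>E - B. h S * deg j E S) \<le> \<kappa> * N * N\<^sup>2"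
    proof -
      have "sqrt (card E) \<le> N\<^sup>2"
      proof (rule real_le_lsqrt)
        have "real (card E) = N ^ 3" by simp
        also have "\<dots> \<le> N ^ 4" using N_ge_1 by (intro power_increasing) auto
        finally show "real (card E) \<le> (N\<^sup>2)\<^sup>2" by (simp flip: power_mult)
      qed simp_all
      then have "(\<Sum>S\<in>E - B. h S * deg j E S) \<le> (\<Sum>S\<in>E - B. h S * N\<^sup>2)"
        using nonneg by (intro sum_mono mult_left_mono) (auto simp: B_def)
      also have "\<dots> \<le> (\<Sum>S\<in>E. h S * N\<^sup>2)" using nonneg finite_E by (intro sum_mono2) auto
      also have "\<dots> = sum h E * N\<^sup>2" by (simp only: sum_distrib_right)
      also have "\<dots> \<le> \<kappa> * N * N\<^sup>2" using h by (intro mult_right_mono) (auto simp: \<kappa>_def mult_ac)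
      finally show ?thesis .
    qed
    also have "(\<Sum>S\<in>E - B. \<Sum>Q | Q \<in> E \<and> G j S Q. t S Q) \<le> \<kappa> * N ^ 3"
    proof -
      have "(\<Sum>S\<in>E - B. \<Sum>Q | Q \<in> E \<and> G j S Q. t S Q) \<le> (\<Sum>S\<in>E. \<Sum>Q | Q \<in> E \<and> G j S Q. t S Q)"
        using finite_E nonneg by (intro sum_mono2) (auto intro: sum_nonneg)
      also have "\<dots> = (\<Sum>Q\<in>E. \<Sum>S | S \<in> E \<and> G j S Q. t S Q)" by (intro sum.swap_restrict finite_E)
      also have "\<dots> \<le> (\<Sum>Q\<in>E. \<kappa>)" using t by (intro sum_mono) (auto simp: \<kappa>_def)
      finally show ?thesis by (simp add: mult.commute)
    qed
    also have "60 * K\<^sup>2 * \<kappa> * (N * N\<^sup>2 + N\<^sup>2) \<le> 60 * K\<^sup>2 * \<kappa> * (N * N\<^sup>2 + N * N\<^sup>2)"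
      using \<kappa> N_ge_1 by (intro mult_left_mono add_left_mono) (auto simp: mult_le_cancel_right1)
    also have "60 * K\<^sup>2 * \<kappa> * (N * N\<^sup>2 + N * N\<^sup>2) + \<kappa> * N * N\<^sup>2 + \<kappa> * N ^ 3 = (120 * K\<^sup>2 + 2) * (\<kappa> * N ^ 3)"
      by (simp only: power3_eq_cube power2_eq_square) (simp only: algebra_simps)
    also have "\<dots> \<le> 2 * c * (\<kappa> * N ^ 3)"
      using \<kappa> N_pos by (intro mult_right_mono) (auto simp: step_factor_def)
    also have "\<dots> = 2 * c ^ Suc j * N ^ (j + 4)"
    proof -
      have "N ^ (j + 4) = N ^ (j + 1) * N ^ 3" unfolding power_add[symmetric] by (simp add: add.commute)
      then show ?thesis by (simp only: \<kappa>_def power_Suc mult_ac)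
    qed
    finally show ?thesis by simp
  qed
  finally show ?thesis by simp
qed

abbreviation D :: real where "D \<equiv> chain_factor K"

lemma c_le_D: "1 \<le> D" "c \<le> D"
  using c_ge_1 by (auto simp: chain_factor_def intro: add_increasing)

theorem total_walks_bound:
  "total_walks G E k \<le> D ^ (k + 1) * N ^ (if k mod 3 = 2 then k + 4 else k + 3)"
proof (induction k rule: less_induct)
  case (less k)
  define b where "b k = (if k mod 3 = 2 then k + 4 else k + 3 :: nat)" for k
  show ?case
  proof (cases k)
    case 0
    have "total_walks G E 0 = 1 * N ^ 3" by (simp add: total_walks_def)
    also have "\<dots> \<le> D * N ^ 3" using c_le_D by (intro mult_right_mono) auto
    finally show ?thesis by (simp add: 0)
  next
    case (Suc j)
    define M where "M = D ^ k * N ^ (b k - 3)"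
    have b3: "b k \<ge> 3" "b k \<ge> k + 3" by (auto simp: b_def)
    have M: "walks G E j S {} \<le> M" if S: "S \<in> E" for S
    proof -
      consider "j = 0" | "j = 1" | i where "j = Suc (Suc i)"
        by (metis One_nat_def not0_implies_Suc)
      then show ?thesis
      proof cases
        case 1
        have "1 * 1 \<le> M"
          unfolding M_def using c_le_D N_ge_1 by (intro mult_mono one_le_power) auto
        then show ?thesis using 1 by simp
      next
        case 2
        have "walks G E j S {} \<le> real (card E)"
          using card_mono[OF finite_E, of "{R \<in> E. G 0 R S}"] 2 by auto
        also have "\<dots> = 1 * N ^ 3" by simp
        also have "\<dots> \<le> M"
          unfolding M_def using c_le_D N_pos 2 Suc by (intro mult_mono one_le_power) (auto simp: b_def)
        finally show ?thesis .
      next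
        case (3 i)
        have "walks G E j S {} \<le> total_walks G E i" using walks_le_total[OF S] 3 by simp
        also have "\<dots> \<le> D ^ (i + 1) * N ^ b i" using less.IH[of i] 3 Suc by (simp add: b_def)
        also have "b i = b k - 3" using 3 Suc by (simp add: b_def mod_simps)
        also have "D ^ (i + 1) * N ^ (b k - 3) \<le> M"
          unfolding M_def using c_le_D N_pos 3 Suc by (intro mult_right_mono power_increasing) auto
        finally show ?thesis .
      qed
    qed
    have M0: "M \<ge> 0" using c_le_D N_pos by (simp add: M_def)
    have "total_walks G E k \<le> 81 * K ^ 4 * N ^ 3 * M + 2 * c ^ k * N ^ (k + 3)"
      using total_walks_step[OF M M0] Suc by (simp add: add.commute)
    also have "\<dots> \<le> 81 * K ^ 4 * (D ^ k * N ^ b k) + 2 * c * (D ^ k * N ^ b k)"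
    proof (intro add_mono)
      have "N ^ b k = N ^ 3 * N ^ (b k - 3)" unfolding power_add[symmetric] using b3 by simp
      then have "81 * K ^ 4 * N ^ 3 * M = 81 * K ^ 4 * (D ^ k * N ^ b k)" by (simp only: M_def mult_ac)
      then show "81 * K ^ 4 * N ^ 3 * M \<le> 81 * K ^ 4 * (D ^ k * N ^ b k)" by (rule eq_refl)
      have "c ^ k = c * c ^ j" using Suc by simp
      also have "\<dots> \<le> c * D ^ k"
      proof (rule mult_left_mono)
        have "c ^ j \<le> D ^ j" using c_ge_1 c_le_D by (intro power_mono) auto
        also have "\<dots> \<le> D ^ k" using c_le_D Suc by (intro power_increasing) auto
        finally show "c ^ j \<le> D ^ k" .
      qed (use c_ge_1 in simp)
      finally have "2 * c ^ k * N ^ (k + 3) \<le> 2 * (c * D ^ k) * N ^ b k"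
        using N_ge_1 b3 c_ge_1 c_le_D by (intro mult_mono power_increasing) auto
      then show "2 * c ^ k * N ^ (k + 3) \<le> 2 * c * (D ^ k * N ^ b k)" by (simp add: mult.assoc)
    qed
    also have "\<dots> = D ^ (k + 1) * N ^ b k" by (simp add: chain_factor_def algebra_simps)
    finally show ?thesis by (simp add: b_def)
  qed
qed

end

section \<open>Dot product chains\<close>

lemma dot_products_determine:
  fixes P Q R R' :: "real ^ 2"
  assumes nc: "\<not> collinear {0, P, Q}" and eq: "P \<bullet> R = P \<bullet> R'" "Q \<bullet> R = Q \<bullet> R'"
  shows "R = R'"
proof -
  define d where "d = R - R'"
  have "P \<bullet> d = 0" "Q \<bullet> d = 0" using eq by (simp_all add: d_def inner_diff_right)
  then have d: "P$1 * d$1 + P$2 * d$2 = 0" "Q$1 * d$1 + Q$2 * d$2 = 0"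
    by (simp_all add: inner_vec_def sum_2)
  define D where "D = P$1 * Q$2 - P$2 * Q$1"
  have "D \<noteq> 0"
  proof
    assume "D = 0"
    then have D: "P$1 * Q$2 = P$2 * Q$1" by (simp add: D_def)
    have "P \<noteq> 0" using nc by (auto simp: collinear_lemma)
    then have "P$1 \<noteq> 0 \<or> P$2 \<noteq> 0" by (auto simp: vec_eq_iff forall_2)
    then have "\<exists>a. Q = a *\<^sub>R P"
    proof
      assume "P$1 \<noteq> 0"
      then show ?thesis using D by (intro exI[of _ "Q$1 / P$1"]) (simp add: vec_eq_iff forall_2 field_simps)
    next
      assume "P$2 \<noteq> 0"
      then show ?thesis using D by (intro exI[of _ "Q$2 / P$2"]) (simp add: vec_eq_iff forall_2 field_simps)
    qed
    then show False using nc by (simp add: collinear_lemma)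
  qed
  moreover have "D * d$1 = 0" "D * d$2 = 0" unfolding D_def using d by algebra+
  ultimately have "d = 0" by (simp add: vec_eq_iff forall_2)
  then show ?thesis by (simp add: d_def)
qed

text \<open>
  Beyond the end of the list the relation is empty, so that the incidence and uniqueness properties hold
  at every index.
\<close>

definition dot_graph :: "real list \<Rightarrow> nat \<Rightarrow> 'a::real_inner \<Rightarrow> 'a \<Rightarrow> bool" where
  "dot_graph as j P R \<longleftrightarrow> j < length as \<and> P \<bullet> R = as ! j"

text \<open>
  For \<open>x \<noteq> x'\<close> in \<open>E\<close> the lines \<open>{y. x \<bullet> y = \<alpha>}\<close> and \<open>{y. x' \<bullet> y = \<alpha>}\<close> are not parallel, as
  \<open>x\<close> and \<open>x'\<close> are not collinear with the origin.  The constant \<open>4\<close> is that of \<open>Szemeredi_Trotter_convex\<close>.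
\<close>

lemma incidence_system_dot_graph:
  fixes E :: "(real ^ 2) set"
  assumes fin: "finite E" and nc: "\<forall>P\<in>E. \<forall>Q\<in>E. P \<noteq> Q \<longrightarrow> \<not> collinear {0, P, Q}" and n: "card E \<ge> 64"
  shows "incidence_system E (dot_graph as) 4"
proof
  show "(2 * 4)\<^sup>2 \<le> real (card E)" using n by simp
next
  fix X Y :: "(real ^ 2) set" and i assume XY: "X \<subseteq> E" "Y \<subseteq> E"
  show "real (\<Sum>x\<in>X. card {y \<in> Y. dot_graph as i x y})
          \<le> 4 * ((cbrt_card X)\<^sup>2 * (cbrt_card Y)\<^sup>2 + real (card X) + real (card Y))"
  proof (cases "i < length as")
    case True
    let ?l = "\<lambda>x. {y. x \<bullet> y = as ! i}"
    have "real (\<Sum>x\<in>X. card (Y \<inter> ?l x))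
      \<le> 4 * (real (card Y) powr (2/3) * real (card X) powr (2/3) + card Y + card X)"
    proof (rule Szemeredi_Trotter_convex)
      show "u = v" if "x \<in> X" "x' \<in> X" "x \<noteq> x'" "u \<in> ?l x \<inter> ?l x'" "v \<in> ?l x \<inter> ?l x'" for x x' u v
        using that XY nc by (intro dot_products_determine[of x x']) auto
    qed (use XY fin finite_subset in \<open>auto simp: convex_hyperplane\<close>)
    moreover have "Y \<inter> ?l x = {y \<in> Y. dot_graph as i x y}" for x using True by (auto simp: dot_graph_def)
    ultimately show ?thesis by (simp add: powr_two_thirds algebra_simps)
  qed (simp add: dot_graph_def)
next
  fix P Q R R' :: "real ^ 2" and i
  assume "P \<in> E" "Q \<in> E" "P \<noteq> Q" "dot_graph as i P R" "dot_graph as (Suc i) R Q"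
    "dot_graph as i P R'" "dot_graph as (Suc i) R' Q"
  then show "R = R'"
    using nc by (intro dot_products_determine[of P Q]) (auto simp: dot_graph_def inner_commute)
qed (use fin in simp_all)

lemma distinct_dot_chains_are_walks:
  "{Rs \<in> dot_chains as E. distinct Rs} \<subseteq> walk_lists (dot_graph as) E (length as)"
  by (auto simp: dot_chains_def walk_lists_def dot_graph_def nth_eq_iff_index_eq)

theorem corollary1p5:
  fixes k :: nat and \<epsilon> :: real
  assumes "k \<ge> 1" and "\<epsilon> > 0"
  shows "\<exists>(C::real) (N::nat). C > 0 \<and>
    (\<forall>n>N. \<forall>(E :: (real ^ 2) set) (as :: real list).
       finite E \<and> card E = n \<and>
       (\<forall>P\<in>E. \<forall>Q\<in>E. P \<noteq> Q \<longrightarrow> \<not> collinear {0, P, Q}) \<and>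
       length as = k \<and> (\<forall>\<alpha>\<in>set as. \<alpha> \<noteq> 0)
       \<longrightarrow> real (card {Rs \<in> dot_chains as E. distinct Rs})
           \<le> C * (if k mod 3 = 0 then real n powr ((real k + 3) / 3)
                   else if k mod 3 = 1 then real n powr ((real k + 3) / 3 + \<epsilon>)
                   else real n powr ((real k + 4) / 3)))"
proof -
  define C where "C = chain_factor 4 ^ (k + 1)"
  have "C > 0" by (simp add: C_def chain_factor_def step_factor_def)
  have bound: "real (card {Rs \<in> dot_chains as E. distinct Rs})
      \<le> C * real (card E) powr ((if k mod 3 = 2 then real k + 4 else real k + 3) / 3)"
    if "card E > 64" "finite E" "\<forall>P\<in>E. \<forall>Q\<in>E. P \<noteq> Q \<longrightarrow> \<not> collinear {0, P, Q}" "length as = k"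
    for E :: "(real ^ 2) set" and as :: "real list"
  proof -
    interpret incidence_system E "dot_graph as" 4
      using that by (intro incidence_system_dot_graph) auto
    have "real (card {Rs \<in> dot_chains as E. distinct Rs}) \<le> card (walk_lists (dot_graph as) E k)"
      using distinct_dot_chains_are_walks[of as E] that(4) finite_walk_lists[OF finite_E]
      by (simp add: card_mono)
    also have "\<dots> \<le> total_walks (dot_graph as) E k" by (rule card_walk_lists[OF finite_E])
    also have "\<dots> \<le> C * N ^ (if k mod 3 = 2 then k + 4 else k + 3)"
      unfolding C_def by (rule total_walks_bound)
    also have "N ^ (if k mod 3 = 2 then k + 4 else k + 3)
        = real (card E) powr ((if k mod 3 = 2 then real k + 4 else real k + 3) / 3)"
      using that(1) by (subst root_3_power) auto
    finally show ?thesis .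
  qed
  show ?thesis
  proof (intro exI[of _ C] exI[of _ 64] conjI allI impI, goal_cases)
    case (2 n E as)
    have "real n powr ((if k mod 3 = 2 then real k + 4 else real k + 3) / 3)
        \<le> (if k mod 3 = 0 then real n powr ((real k + 3) / 3)
            else if k mod 3 = 1 then real n powr ((real k + 3) / 3 + \<epsilon>)
            else real n powr ((real k + 4) / 3))"
    proof -
      consider "k mod 3 = 0" | "k mod 3 = 1" | "k mod 3 = 2" by linarith
      then show ?thesis using 2 \<open>\<epsilon> > 0\<close> by cases (auto intro: powr_mono)
    qed
    then have "C * real n powr ((if k mod 3 = 2 then real k + 4 else real k + 3) / 3)
        \<le> C * (if k mod 3 = 0 then real n powr ((real k + 3) / 3)
            else if k mod 3 = 1 then real n powr ((real k + 3) / 3 + \<epsilon>)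
            else real n powr ((real k + 4) / 3))"
      using \<open>C > 0\<close> by (intro mult_left_mono) auto
    moreover have "real (card {Rs \<in> dot_chains as E. distinct Rs})
        \<le> C * real n powr ((if k mod 3 = 2 then real k + 4 else real k + 3) / 3)"
      using bound[of E as] 2 by blast
    ultimately show ?case by (rule order_trans[rotated])
  qed (fact \<open>C > 0\<close>)
qed

end
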